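(* Let $n\ge 3$ and $1\le k\le n-2$ be integers, and let $x_1,\dots,x_{k+1}\in\mathbb{R}^n$ be points in general position, i.e. the vectors $x_{k+1}-x_1,\dots,x_{k+1}-x_k$ are linearly independent. Let $\mathcal{H}'=\mathcal{H}'_{x_1,\dots,x_{k+1}}$ be the family of $k$-dimensional planes $\Sigma_{x_0}$ defined in the context. Let $f\in C^\infty(\mathbb{R}^n)$ satisfy $f(x)=o(|x|^{-N})$ as $|x|\to\infty$ for some $N>k+1$. Then $f$ can be recovered from its $k$-dimensional Radon transform $\mathcal{R}_kf$ restricted to $\mathcal{H}'$. That is, $f$ is uniquely determined by the integrals $(\mathcal{R}_kf)(\Sigma)$, $\Sigma\in\mathcal{H}'$: if $f_1,f_2\in C^\infty(\mathbb{R}^n)$ satisfy $f_1(x)=o(|x|^{-N})$ and $f_2(x)=o(|x|^{-N})$ as $|x|\to\infty$ for some $N>k+1$, and $(\mathcal{R}_kf_1)(\Sigma)=(\mathcal{R}_kf_2)(\Sigma)$ for all $\Sigma\in\mathcal{H}'$, then $f_1=f_2$ on $\mathbb{R}^n$.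
   Context: A $k$-plane is a $k$-dimensional affine subspace of $\mathbb{R}^n$. For a $k$-plane $\Sigma$, $(\mathcal{R}_kf)(\Sigma)=\int_\Sigma f\,dm_\Sigma$, where $dm_\Sigma$ is the standard $k$-dimensional area (Lebesgue) measure on $\Sigma$. Functions are real-valued. For points $y_1,\dots,y_{m+1}$ in general position (affinely independent), $\mathbf{H}\{y_1,\dots,y_{m+1}\}$ denotes the unique $m$-plane passing through them. For $x_0\in\mathbb{R}^n\setminus\{0\}$, $\mathbf{H}_{x_0}=\{x\in\mathbb{R}^n:\langle x-x_0,x_0\rangle=0\}$ is the hyperplane whose closest point to the origin is $x_0$. Put $$\mathbf{U}\{x_1,\dots,x_{k+1}\}=\{x\in\mathbb{R}^n:\langle x-x_1,x\rangle=\dots=\langle x-x_{k+1},x\rangle=0\}$$ (in particular $0\in\mathbf{U}\{x_1,\dots,x_{k+1}\}$). For $x_0\in\mathbb{R}^n\setminus(\mathbf{H}\{x_1,\dots,x_{k+1}\}\cup\mathbf{U}\{x_1,\dots,x_{k+1}\})$ define $$\Sigma_{x_0}=\mathbf{H}\{x_0,x_1,\dots,x_{k+1}\}\cap\mathbf{H}_{x_0},$$ which is a $k$-plane containing $x_0$. The family is $$\mathcal{H}'_{x_1,\dots,x_{k+1}}=\{\Sigma_{x_0}:x_0\in\mathbb{R}^n\setminus(\mathbf{H}\{x_1,\dots,x_{k+1}\}\cup\mathbf{U}\{x_1,\dots,x_{k+1}\})\}.$$ *)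

theory Defs
  imports "HOL-Analysis.Analysis" "HOL-Library.Landau_Symbols"
begin

(* Continuously differentiable m times on the whole space: f is differentiable everywhere and all
   its first partial derivatives are m - 1 times continuously differentiable. *)
fun C_times :: "nat \<Rightarrow> (real ^ 'n \<Rightarrow> real) \<Rightarrow> bool" where
  "C_times 0 f \<longleftrightarrow> continuous_on UNIV f"
| "C_times (Suc m) f \<longleftrightarrow>
     f differentiable_on UNIV \<and> (\<forall>i. C_times m (\<lambda>x. frechet_derivative f (at x) (axis i 1)))"

definition C_infinity :: "(real ^ 'n \<Rightarrow> real) \<Rightarrow> bool" where
  "C_infinity f \<longleftrightarrow> (\<forall>m. C_times m f)"

(* (p, e) is an orthonormal frame of the k-plane S: p is a base point, and e 0, ..., e (k - 1) is an
   orthonormal basis of the direction space. Such a frame exists iff S is a k-dimensional affine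
   subspace; the values e i with i \<ge> k are irrelevant. *)
definition plane_frame :: "nat \<Rightarrow> (real ^ 'n) set \<Rightarrow> real ^ 'n \<Rightarrow> (nat \<Rightarrow> real ^ 'n) \<Rightarrow> bool" where
  "plane_frame k S p e \<longleftrightarrow>
     (\<forall>i<k. \<forall>j<k. e i \<bullet> e j = (if i = j then 1 else 0)) \<and>
     S = range (\<lambda>t :: nat \<Rightarrow> real. p + (\<Sum>i<k. t i *\<^sub>R e i))"

(* The k-dimensional area measure on the k-plane S, as a Borel measure on the ambient space: the
   image of Lebesgue measure on k-dimensional coordinate space under the isometric
   parametrization given by an orthonormal frame. Lebesgue measure being invariant under
   isometries, the result does not depend on which frame is chosen. *)
definition plane_measure :: "nat \<Rightarrow> (real ^ 'n) set \<Rightarrow> (real ^ 'n) measure" where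
  "plane_measure k S =
     (let (p, e) = (SOME (p, e). plane_frame k S p e)
      in distr (\<Pi>\<^sub>M i\<in>{..<k}. lborel) borel (\<lambda>t. p + (\<Sum>i<k. t i *\<^sub>R e i)))"

definition radon_transform :: "nat \<Rightarrow> (real ^ 'n \<Rightarrow> real) \<Rightarrow> (real ^ 'n) set \<Rightarrow> real" where
  "radon_transform k f S = (\<integral>x. f x \<partial>plane_measure k S)"

(* Injectivity is part of linear independence of the indexed family. *)
definition general_position :: "nat \<Rightarrow> (nat \<Rightarrow> real ^ 'n) \<Rightarrow> bool" where
  "general_position k x \<longleftrightarrow>
     inj_on (\<lambda>i. x (k + 1) - x i) {1..k} \<and> independent ((\<lambda>i. x (k + 1) - x i) ` {1..k})"

definition foot_hyperplane :: "real ^ 'n \<Rightarrow> (real ^ 'n) set" where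
  "foot_hyperplane x0 = {y. (y - x0) \<bullet> x0 = 0}"

definition U_set :: "nat \<Rightarrow> (nat \<Rightarrow> real ^ 'n) \<Rightarrow> (real ^ 'n) set" where
  "U_set k x = {y. \<forall>i\<in>{1..k + 1}. (y - x i) \<bullet> y = 0}"

(* The plane H{y_1, ..., y_(m+1)} through affinely independent points is their affine hull. *)
definition Sigma_plane :: "nat \<Rightarrow> (nat \<Rightarrow> real ^ 'n) \<Rightarrow> real ^ 'n \<Rightarrow> (real ^ 'n) set" where
  "Sigma_plane k x x0 = affine hull (insert x0 (x ` {1..k + 1})) \<inter> foot_hyperplane x0"

definition plane_family :: "nat \<Rightarrow> (nat \<Rightarrow> real ^ 'n) \<Rightarrow> (real ^ 'n) set set" where
  "plane_family k x =
     {Sigma_plane k x x0 | x0. x0 \<notin> affine hull (x ` {1..k + 1}) \<union> U_set k x}"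

end

theory Submission
  imports Defs "HOL-Probability.Probability"
begin

text \<open>
  Let \<open>P\<close> be a \<open>(k + 1)\<close>-plane containing \<open>x 1, \<dots>, x (k + 1)\<close>, with direction space \<open>W\<close>, and let \<open>q\<close> be
  the foot of the perpendicular from the origin to \<open>P\<close>. For a unit vector \<open>\<omega> \<in> W\<close> the
  plane \<open>\<Sigma>\<close> of the family belonging to \<open>q + r \<omega>\<close> is the hyperplane of \<open>P\<close> through this point with normal \<open>\<omega>\<close>.
  If \<open>\<omega>\<close> is not parallel to \<open>H{x 1, \<dots>, x (k + 1)}\<close>, only finitely many \<open>r\<close> are excluded, so the
  Radon transform on the family determines the Fourier transform of \<open>f\<close> restricted to \<open>P\<close> in almost every
  direction; it exists since \<open>N > k + 1\<close> makes the restriction integrable. Every point lies on such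
  a \<open>P\<close>, and the restriction to \<open>P\<close> is recovered from its Fourier transform by Gaussian averaging.
\<close>

section \<open>Area measure on planes\<close>

abbreviation leb :: "nat \<Rightarrow> (nat \<Rightarrow> real) measure" where
  "leb k \<equiv> \<Pi>\<^sub>M i\<in>{..<k}. lborel"

text \<open>The linear part of the parametrization in \<open>plane_measure\<close>, kept apart from
  the base point so that shifts inside the direction space become shifts of coordinates.\<close>

definition frame_map :: "nat \<Rightarrow> (nat \<Rightarrow> 'a::euclidean_space) \<Rightarrow> (nat \<Rightarrow> real) \<Rightarrow> 'a" where
  "frame_map k e t = (\<Sum>i<k. t i *\<^sub>R e i)"

definition orthonormal_upto :: "nat \<Rightarrow> (nat \<Rightarrow> 'a::euclidean_space) \<Rightarrow> bool" where
  "orthonormal_upto k e \<longleftrightarrow> (\<forall>i<k. \<forall>j<k. e i \<bullet> e j = (if i = j then 1 else 0))"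

interpretation lborel_product: product_sigma_finite "\<lambda>i::nat. lborel :: real measure"
  by standard

lemma sigma_finite_leb: "sigma_finite_measure (leb k)"
  by (rule lborel_product.sigma_finite) simp

lemma measurable_leb_component [measurable (raw)]:
  "i < k \<Longrightarrow> (\<lambda>t. t i) \<in> borel_measurable (leb k)"
  using measurable_component_singleton[of i "{..<k}" "\<lambda>_. lborel"] by simp

lemma measurable_frame_map [measurable]: "frame_map k e \<in> borel_measurable (leb k)"
  unfolding frame_map_def
  by (intro borel_measurable_sum borel_measurable_scaleR measurable_leb_component) auto

text \<open>On a box the claim splits into coordinates, where it is the affine invariance of
  \<open>lborel\<close>. Only shifts (\<open>c = 1\<close>) and reflections (\<open>c = -1\<close>)
  occur. Points of the product space are extensional, hence the restriction to
  \<open>{..<k}\<close>.\<close>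

lemma distr_leb_affine:
  fixes a :: "nat \<Rightarrow> real" and c :: real
  assumes c: "\<bar>c\<bar> = 1"
  shows "distr (leb k) (leb k) (\<lambda>t. \<lambda>i\<in>{..<k}. a i + c * t i) = leb k"
proof (rule lborel_product.PiM_eqI)
  let ?T = "\<lambda>t. \<lambda>i\<in>{..<k}. a i + c * t i"
  have 1: "distr lborel borel (\<lambda>x. b + c * x) = lborel" for b
    using lborel_real_affine[of c b] c by (auto simp: density_1)
  have 2[measurable]: "?T \<in> measurable (leb k) (leb k)"
    by (intro measurable_restrict) auto
  fix A :: "nat \<Rightarrow> real set" assume A: "\<And>i. i \<in> {..<k} \<Longrightarrow> A i \<in> sets lborel"
  have "?T -` Pi\<^sub>E {..<k} A \<inter> space (leb k) = Pi\<^sub>E {..<k} (\<lambda>i. (\<lambda>x. a i + c * x) -` A i)"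
    by (auto simp: space_PiM PiE_def Pi_def extensional_def)
  moreover have "(\<lambda>x. a i + c * x) -` A i \<in> sets borel" if "i < k" for i
    using A[of i] that measurable_sets[of "\<lambda>x. a i + c * x" borel borel "A i"] by simp
  moreover have "emeasure lborel ((\<lambda>x. a i + c * x) -` A i) = emeasure lborel (A i)" if "i < k" for i
    using A[of i] that emeasure_distr[of "\<lambda>x. a i + c * x" lborel borel "A i"] by (simp add: 1)
  ultimately have "emeasure (leb k) (?T -` Pi\<^sub>E {..<k} A \<inter> space (leb k))
      = (\<Prod>i\<in>{..<k}. emeasure lborel (A i))"
    by (simp only:) (subst lborel_product.emeasure_PiM, auto)
  then show "emeasure (distr (leb k) (leb k) ?T) (Pi\<^sub>E {..<k} A) = (\<Prod>i\<in>{..<k}. emeasure lborel (A i))"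
    using A by (subst emeasure_distr) (auto intro!: sets_PiM_I_finite)
qed auto

lemma nn_integral_leb_affine:
  assumes "\<bar>c\<bar> = 1" and [measurable]: "g \<in> borel_measurable (leb k)"
  shows "(\<integral>\<^sup>+ t. g (\<lambda>i\<in>{..<k}. a i + c * t i) \<partial>leb k) = (\<integral>\<^sup>+ t. g t \<partial>leb k)"
proof -
  have "(\<lambda>t. \<lambda>i\<in>{..<k}. a i + c * t i) \<in> measurable (leb k) (leb k)"
    by (intro measurable_restrict) auto
  then show ?thesis
    by (subst (2) distr_leb_affine[OF assms(1), of k a, symmetric]) (simp add: nn_integral_distr)
qed

lemma frame_map_restrict [simp]: "frame_map k e (\<lambda>i\<in>{..<k}. f i) = frame_map k e f"
  by (auto simp: frame_map_def intro!: sum.cong)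

lemma frame_map_add: "frame_map k e (\<lambda>i. s i + t i) = frame_map k e s + frame_map k e t"
  by (simp add: frame_map_def scaleR_add_left sum.distrib)

lemma frame_map_minus: "frame_map k e (\<lambda>i. - t i) = - frame_map k e t"
  by (simp add: frame_map_def sum_negf)

lemma inner_frame_map:
  assumes "orthonormal_upto k e" "i < k"
  shows "frame_map k e t \<bullet> e i = t i"
proof -
  have "frame_map k e t \<bullet> e i = (\<Sum>j<k. if j = i then t j else 0)"
    unfolding frame_map_def inner_sum_left
    using assms by (intro sum.cong) (auto simp: orthonormal_upto_def)
  then show ?thesis using assms(2) by simp
qed

lemma norm_frame_map:
  "orthonormal_upto k e \<Longrightarrow> (norm (frame_map k e t))\<^sup>2 = (\<Sum>i<k. (t i)\<^sup>2)"
  by (subst power2_norm_eq_inner, subst (2) frame_map_def)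
     (simp add: inner_sum_right inner_frame_map power2_eq_square)

lemma frame_map_in_span: "frame_map k e t \<in> span (e ` {..<k})"
  unfolding frame_map_def by (intro span_sum span_scale span_base) auto

lemma frame_map_coords:
  assumes e: "orthonormal_upto k e" and v: "v \<in> span (e ` {..<k})"
  shows "frame_map k e (\<lambda>i. v \<bullet> e i) = v"
  using v
proof (induction rule: span_induct_alt)
  case base
  show ?case by (simp add: frame_map_def)
next
  case (step c x y)
  then obtain j where j: "j < k" "x = e j" by auto
  have "frame_map k e (\<lambda>i. x \<bullet> e i) = x"
    using e j by (simp add: frame_map_def orthonormal_upto_def if_distrib[of "\<lambda>r. r *\<^sub>R _"] cong: if_cong)
  moreover have "frame_map k e (\<lambda>i. (c *\<^sub>R x + y) \<bullet> e i)
      = c *\<^sub>R frame_map k e (\<lambda>i. x \<bullet> e i) + frame_map k e (\<lambda>i. y \<bullet> e i)"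
    by (simp add: frame_map_def inner_add_left scaleR_add_left sum.distrib scaleR_sum_right)
  ultimately show ?case using step by simp
qed

lemma range_frame_map:
  assumes "orthonormal_upto k e"
  shows "range (frame_map k e) = span (e ` {..<k})"
proof (intro equalityI subsetI)
  fix v assume "v \<in> span (e ` {..<k})"
  then have "v = frame_map k e (\<lambda>i. v \<bullet> e i)" using frame_map_coords[OF assms] by simp
  then show "v \<in> range (frame_map k e)" by blast
qed (auto simp: frame_map_in_span)

section \<open>Independence of the area measure from the frame\<close>

lemma emeasure_leb_box:
  "r > 0 \<Longrightarrow> emeasure (leb k) (Pi\<^sub>E {..<k} (\<lambda>_. {-r<..<r})) = ennreal ((2 * r) ^ k)"
  by (subst lborel_product.emeasure_PiM) (auto simp: ennreal_power)

text \<open>Orthonormal frames preserve the norm, so the unit ball pulls back to the same coordinate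
  ball for every frame. This is what makes the normalizing constants of two frames agree.\<close>

lemma frame_ball_volume:
  assumes e: "orthonormal_upto k e"
  shows "(\<integral>\<^sup>+ t. indicator {v. norm v < 1} (frame_map k e t) \<partial>leb k)
      = (\<integral>\<^sup>+ t. indicator {t. (\<Sum>i<k. (t i)\<^sup>2) < 1} t \<partial>leb k)"
proof -
  have "norm (frame_map k e t) < 1 \<longleftrightarrow> (\<Sum>i<k. (t i)\<^sup>2) < 1" for t
    using norm_frame_map[OF e, of t] by (metis abs_norm_cancel abs_square_less_1)
  then show ?thesis by (simp add: indicator_def)
qed

text \<open>A factor in \<open>ennreal\<close> can be cancelled only if it is neither zero nor
  infinite. The ball is compared with a box around it and a box inside it.\<close>

lemma ball_volume_bounds:
  fixes k :: nat
  defines "v \<equiv> \<integral>\<^sup>+ t. indicator {t. (\<Sum>i<k. (t i)\<^sup>2) < 1} t \<partial>leb k"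
  shows "v > 0" "v < \<infinity>"
proof -
  have [measurable]: "{t. (\<Sum>i<k. (t i)\<^sup>2) < 1} \<inter> space (leb k) \<in> sets (leb k)"
  proof -
    have "{t \<in> space (leb k). (\<Sum>i<k. (t i)\<^sup>2) < 1} \<in> sets (leb k)"
      by (intro borel_measurable_less borel_measurable_sum borel_measurable_power
            measurable_leb_component borel_measurable_const) auto
    then show ?thesis by (simp add: Int_def conj_commute)
  qed
  have "v \<le> (\<integral>\<^sup>+ t. indicator (Pi\<^sub>E {..<k} (\<lambda>_. {-2<..<2})) t \<partial>leb k)"
    unfolding v_def
  proof (rule nn_integral_mono)
    fix t assume t: "t \<in> space (leb k)"
    have "t \<in> Pi\<^sub>E {..<k} (\<lambda>_. {-2<..<2})" if "(\<Sum>i<k. (t i)\<^sup>2) < 1"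
    proof -
      have "\<bar>t i\<bar> < 1" if "i < k" for i
      proof -
        have "(t i)\<^sup>2 \<le> (\<Sum>i<k. (t i)\<^sup>2)" using that by (intro member_le_sum) auto
        then show ?thesis
          using \<open>(\<Sum>i<k. (t i)\<^sup>2) < 1\<close> abs_square_less_1[of "t i"] by linarith
      qed
      then show ?thesis using t by (force simp: space_PiM PiE_def Pi_def abs_less_iff)
    qed
    then show "indicator {t. (\<Sum>i<k. (t i)\<^sup>2) < 1} t \<le> (indicator (Pi\<^sub>E {..<k} (\<lambda>_. {-2<..<2})) t :: ennreal)"
      by (auto simp: indicator_def)
  qed
  also have "\<dots> = ennreal (4 ^ k)"
    by (subst nn_integral_indicator) (auto simp: emeasure_leb_box intro!: sets_PiM_I_finite)
  finally show "v < \<infinity>" by (rule le_less_trans) simp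
  \<comment> \<open>In the box of half side \<open>r\<close> each square is at most
    \<open>r\<close>, so their sum is at most \<open>k * r < 1\<close>. The choice also covers
    \<open>k = 0\<close>.\<close>
  define r :: real where "r = 1 / (k + 1)"
  have r: "0 < r" "r \<le> 1" "k * r < 1" by (auto simp: r_def field_simps)
  have "0 < ennreal ((2 * r) ^ k)" using r by simp
  also have "\<dots> = (\<integral>\<^sup>+ t. indicator (Pi\<^sub>E {..<k} (\<lambda>_. {-r<..<r})) t \<partial>leb k)"
    using r by (subst nn_integral_indicator) (auto simp: emeasure_leb_box intro!: sets_PiM_I_finite)
  also have "\<dots> \<le> v"
    unfolding v_def
  proof (rule nn_integral_mono)
    fix t
    have "(\<Sum>i<k. (t i)\<^sup>2) < 1" if t: "t \<in> Pi\<^sub>E {..<k} (\<lambda>_. {-r<..<r})"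
    proof -
      have "(t i)\<^sup>2 \<le> r" if "i < k" for i
      proof -
        have "\<bar>t i\<bar> \<le> r" using t that by (force simp: PiE_def Pi_def)
        then have "(t i)\<^sup>2 \<le> r\<^sup>2" by (rule power2_le_iff_abs_le[THEN iffD2, rotated]) (use r in auto)
        also have "\<dots> \<le> r" using r by (simp add: power2_eq_square mult_left_le)
        finally show ?thesis .
      qed
      then have "(\<Sum>i<k. (t i)\<^sup>2) \<le> (\<Sum>i<k. r)" by (intro sum_mono) auto
      then show ?thesis using r by simp
    qed
    then show "indicator (Pi\<^sub>E {..<k} (\<lambda>_. {-r<..<r})) t \<le> (indicator {t. (\<Sum>i<k. (t i)\<^sup>2) < 1} t :: ennreal)"
      by (auto simp: indicator_def)
  qed
  finally show "v > 0" .
qed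

text \<open>Uniqueness of Haar measure: \<open>\<integral>\<integral> f (E s) g (E s + E' t)\<close> is computed in both orders, with \<open>g\<close> the
  indicator of the unit ball fixing the constant.\<close>

lemma nn_integral_frame_unique:
  fixes e e' :: "nat \<Rightarrow> 'a::euclidean_space"
  assumes e: "orthonormal_upto k e" and e': "orthonormal_upto k e'"
    and span: "span (e ` {..<k}) = span (e' ` {..<k})"
    and f[measurable]: "f \<in> borel_measurable borel"
  shows "(\<integral>\<^sup>+ t. f (frame_map k e t) \<partial>leb k) = (\<integral>\<^sup>+ t. f (frame_map k e' t) \<partial>leb k)"
proof -
  let ?E = "frame_map k e" and ?E' = "frame_map k e'"
  interpret P: pair_sigma_finite "leb k" "leb k"
    using sigma_finite_leb by (simp add: pair_sigma_finite_def)
  define g :: "'a \<Rightarrow> ennreal" where "g = indicator {v. norm v < 1}"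
  have [measurable]: "g \<in> borel_measurable borel" unfolding g_def by measurable
  have sh: "(\<integral>\<^sup>+ t. h (v + frame_map k c t) \<partial>leb k) = (\<integral>\<^sup>+ t. h (frame_map k c t) \<partial>leb k)"
    if [measurable]: "h \<in> borel_measurable borel" and v: "v \<in> span (c ` {..<k})" and c: "orthonormal_upto k c"
    for h :: "'a \<Rightarrow> ennreal" and v c
  proof -
    have "v + frame_map k c t = frame_map k c (\<lambda>i\<in>{..<k}. v \<bullet> c i + 1 * t i)" for t
      using frame_map_coords[OF c v] by (simp add: frame_map_add)
    then show ?thesis
      using nn_integral_leb_affine[of 1 "\<lambda>t. h (frame_map k c t)" k "\<lambda>i. v \<bullet> c i"] by simp
  qed
  have rf: "(\<integral>\<^sup>+ t. h (- frame_map k c t) \<partial>leb k) = (\<integral>\<^sup>+ t. h (frame_map k c t) \<partial>leb k)"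
    if [measurable]: "h \<in> borel_measurable borel" for h :: "'a \<Rightarrow> ennreal" and c
  proof -
    have "- frame_map k c t = frame_map k c (\<lambda>i\<in>{..<k}. 0 + (-1) * t i)" for t
      by (simp add: frame_map_minus)
    then show ?thesis
      using nn_integral_leb_affine[of "-1" "\<lambda>t. h (frame_map k c t)" k "\<lambda>_. 0"] by simp
  qed
  have in1: "?E s \<in> span (e' ` {..<k})" "?E' s \<in> span (e ` {..<k})" "- ?E' s \<in> span (e ` {..<k})" for s
    using frame_map_in_span[of k e s] frame_map_in_span[of k e' s] span by (auto simp: span_neg)
  have "(\<integral>\<^sup>+ s. f (?E s) \<partial>leb k) * (\<integral>\<^sup>+ t. g (?E' t) \<partial>leb k)
      = (\<integral>\<^sup>+ s. f (?E s) * (\<integral>\<^sup>+ t. g (?E' t) \<partial>leb k) \<partial>leb k)"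
    by (simp add: nn_integral_multc)
  also have "\<dots> = (\<integral>\<^sup>+ s. f (?E s) * (\<integral>\<^sup>+ t. g (?E s + ?E' t) \<partial>leb k) \<partial>leb k)"
    using sh[of g] in1 e' by simp
  also have "\<dots> = (\<integral>\<^sup>+ s. (\<integral>\<^sup>+ t. f (?E s) * g (?E s + ?E' t) \<partial>leb k) \<partial>leb k)"
    by (subst nn_integral_cmult[symmetric]) auto
  also have "\<dots> = (\<integral>\<^sup>+ t. (\<integral>\<^sup>+ s. f (?E s) * g (?E s + ?E' t) \<partial>leb k) \<partial>leb k)"
    by (rule P.Fubini'[symmetric]) measurable
  \<comment> \<open>For fixed \<open>t\<close> the inner variable is shifted by
    \<open>- ?E' t\<close>, which is allowed because both frames have the same span. This moves the
    dependence on \<open>t\<close> from \<open>g\<close> to \<open>f\<close>.\<close>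
  also have "\<dots> = (\<integral>\<^sup>+ t. (\<integral>\<^sup>+ s. f (- ?E' t + ?E s) * g (?E s) \<partial>leb k) \<partial>leb k)"
  proof (rule nn_integral_cong)
    fix t
    show "(\<integral>\<^sup>+ s. f (?E s) * g (?E s + ?E' t) \<partial>leb k) = (\<integral>\<^sup>+ s. f (- ?E' t + ?E s) * g (?E s) \<partial>leb k)"
      using sh[of "\<lambda>v. f v * g (v + ?E' t)" "- ?E' t" e] in1 e by simp
  qed
  also have "\<dots> = (\<integral>\<^sup>+ s. (\<integral>\<^sup>+ t. f (- ?E' t + ?E s) * g (?E s) \<partial>leb k) \<partial>leb k)"
    by (rule P.Fubini') measurable
  also have "\<dots> = (\<integral>\<^sup>+ s. (\<integral>\<^sup>+ t. f (- ?E' t + ?E s) \<partial>leb k) * g (?E s) \<partial>leb k)"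
    by (subst nn_integral_multc[symmetric]) auto
  also have "\<dots> = (\<integral>\<^sup>+ s. (\<integral>\<^sup>+ t. f (?E' t) \<partial>leb k) * g (?E s) \<partial>leb k)"
  \<comment> \<open>For fixed \<open>s\<close>, a reflection of \<open>t\<close> followed by a shift
    by \<open>?E s\<close> in the span of \<open>e'\<close> removes \<open>s\<close> from the
    integral of \<open>f\<close>.\<close>
  proof (rule nn_integral_cong)
    fix s
    have "(\<integral>\<^sup>+ t. f (- ?E' t + ?E s) \<partial>leb k) = (\<integral>\<^sup>+ t. f (?E s + ?E' t) \<partial>leb k)"
      using rf[of "\<lambda>v. f (v + ?E s)" e'] by (simp add: add.commute)
    also have "\<dots> = (\<integral>\<^sup>+ t. f (?E' t) \<partial>leb k)" using sh[of f] in1 e' by simp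
    finally show "(\<integral>\<^sup>+ t. f (- ?E' t + ?E s) \<partial>leb k) * g (?E s) = (\<integral>\<^sup>+ t. f (?E' t) \<partial>leb k) * g (?E s)"
      by simp
  qed
  also have "\<dots> = (\<integral>\<^sup>+ t. f (?E' t) \<partial>leb k) * (\<integral>\<^sup>+ s. g (?E s) \<partial>leb k)"
    by (simp add: nn_integral_cmult)
  finally have *: "(\<integral>\<^sup>+ s. f (?E s) \<partial>leb k) * (\<integral>\<^sup>+ t. g (?E' t) \<partial>leb k)
      = (\<integral>\<^sup>+ t. f (?E' t) \<partial>leb k) * (\<integral>\<^sup>+ s. g (?E s) \<partial>leb k)" .
  \<comment> \<open>Both factors with \<open>g\<close> are the volume of the same coordinate ball,
    which is positive and finite and hence cancels.\<close>
  show ?thesis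
    using * ball_volume_bounds[of k] unfolding g_def frame_ball_volume[OF e] frame_ball_volume[OF e']
    by (metis ennreal_mult_cancel_left mult.commute less_irrefl infinity_ennreal_def)
qed

text \<open>Frees \<open>plane_measure\<close> from the choice made by \<open>SOME\<close>. Two
  frames of one plane have the same direction space, so \<open>nn_integral_frame_unique\<close>
  exchanges the directions, and the base points differ by a vector of that space, which is a shift
  of coordinates.\<close>

lemma plane_measure_frame:
  fixes S :: "(real ^ 'n) set"
  assumes "plane_frame k S p e"
  shows "plane_measure k S = distr (leb k) borel (\<lambda>t. p + frame_map k e t)"
proof -
  define pe where "pe = (SOME (p, e). plane_frame k S p e)"
  obtain p' e' where pe: "pe = (p', e')" by (cases pe)
  have fr': "plane_frame k S p' e'"
  proof -
    have "case pe of (p, e) \<Rightarrow> plane_frame k S p e"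
      unfolding pe_def by (rule someI[of _ "(p, e)"]) (use assms in simp)
    then show ?thesis by (simp add: pe)
  qed
  have o: "orthonormal_upto k e" "orthonormal_upto k e'"
    using assms fr' by (auto simp: plane_frame_def orthonormal_upto_def)
  have "S = range (\<lambda>t. p + frame_map k e t)" "S = range (\<lambda>t. p' + frame_map k e' t)"
    using assms fr' by (simp_all add: plane_frame_def frame_map_def)
  then have r: "S = (+) p ` span (e ` {..<k})" "S = (+) p' ` span (e' ` {..<k})"
    using o by (simp_all add: range_frame_map[symmetric] image_image)
  have p': "p' - p \<in> span (e ` {..<k})"
  proof -
    have "p' \<in> S" using r(2) span_zero by force
    then show ?thesis using r(1) by auto
  qed
  \<comment> \<open>The direction space is the plane minus a base point. Passing from one base point
    to the other translates the span by a vector that it contains.\<close>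
  have "span (e' ` {..<k}) = (+) (- p') ` S" using r(2) by (auto simp: image_image)
  also have "\<dots> = (\<lambda>v. v - (p' - p)) ` span (e ` {..<k})"
    unfolding r(1) by (auto simp: image_image algebra_simps)
  also have "\<dots> = span (e ` {..<k})"
  proof (intro equalityI subsetI)
    fix v assume "v \<in> span (e ` {..<k})"
    then have "v = (v + (p' - p)) - (p' - p)" "v + (p' - p) \<in> span (e ` {..<k})"
      using p' by (auto intro: span_add)
    then show "v \<in> (\<lambda>v. v - (p' - p)) ` span (e ` {..<k})" by blast
  qed (use p' in \<open>auto intro: span_diff\<close>)
  finally have sp: "span (e' ` {..<k}) = span (e ` {..<k})" .
  have pm: "plane_measure k S = distr (leb k) borel (\<lambda>t. p' + frame_map k e' t)"
    using pe unfolding plane_measure_def pe_def by (simp add: frame_map_def)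
  show ?thesis unfolding pm
  proof (rule measure_eqI)
    fix A assume "A \<in> sets (distr (leb k) borel (\<lambda>t. p' + frame_map k e' t))"
    then have [measurable]: "A \<in> sets borel" by simp
    have eq: "emeasure (distr (leb k) borel (\<lambda>t. q + frame_map k c t)) A
        = (\<integral>\<^sup>+ t. indicator A (q + frame_map k c t) \<partial>leb k)" for q c
      by (subst nn_integral_indicator[symmetric], simp) (subst nn_integral_distr, auto)
    have "(\<integral>\<^sup>+ t. indicator A (p' + frame_map k e' t) \<partial>leb k)
        = (\<integral>\<^sup>+ t. indicator A (p' + frame_map k e t) \<partial>leb k)"
      using nn_integral_frame_unique[OF o(2,1) sp, of "\<lambda>v. indicator A (p' + v)"] by simp
    also have "\<dots> = (\<integral>\<^sup>+ t. indicator A (p + frame_map k e (\<lambda>i\<in>{..<k}. (p' - p) \<bullet> e i + 1 * t i)) \<partial>leb k)"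
    proof -
      have "p + frame_map k e (\<lambda>i\<in>{..<k}. (p' - p) \<bullet> e i + 1 * t i) = p' + frame_map k e t" for t
        by (simp only: frame_map_restrict frame_map_add frame_map_coords[OF o(1) p'] mult_1) simp
      then show ?thesis by (simp only:)
    qed
    also have "\<dots> = (\<integral>\<^sup>+ t. indicator A (p + frame_map k e t) \<partial>leb k)"
      by (rule nn_integral_leb_affine[where g = "\<lambda>t. indicator A (p + frame_map k e t)"]) auto
    finally show "emeasure (distr (leb k) borel (\<lambda>t. p' + frame_map k e' t)) A
        = emeasure (distr (leb k) borel (\<lambda>t. p + frame_map k e t)) A"
      by (simp add: eq)
  qed simp
qed

section \<open>Gaussian averages of the Fourier transform\<close>

abbreviation gaussian :: "nat \<Rightarrow> (nat \<Rightarrow> real) measure" where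
  "gaussian d \<equiv> \<Pi>\<^sub>M i\<in>{..<d}. std_normal_distribution"

lemma prob_space_std_normal: "prob_space std_normal_distribution"
  using real_dist_normal_dist by (simp add: real_distribution_def)

interpretation gaussian_product: product_sigma_finite "\<lambda>i::nat. std_normal_distribution"
  using prob_space_std_normal by (simp add: product_sigma_finite_def prob_space_imp_sigma_finite)

lemma prob_space_gaussian: "prob_space (gaussian d)"
  by (intro prob_space_PiM prob_space_std_normal)

lemma measurable_gaussian_component [measurable (raw)]:
  "i < d \<Longrightarrow> (\<lambda>t. t i) \<in> borel_measurable (gaussian d)"
  using measurable_component_singleton[of i "{..<d}" "\<lambda>_. std_normal_distribution"] by simp

text \<open>Independent coordinates make the characteristic function a product of one-dimensional
  ones.\<close>

lemma gaussian_char: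
  "(CLINT \<xi> | gaussian d. iexp (\<Sum>i<d. a i * \<xi> i)) = complex_of_real (exp (- (\<Sum>i<d. (a i)\<^sup>2) / 2))"
proof -
  interpret N: prob_space std_normal_distribution by (rule prob_space_std_normal)
  have "(CLINT \<xi> | gaussian d. iexp (\<Sum>i<d. a i * \<xi> i))
      = (CLINT \<xi> | gaussian d. (\<Prod>i<d. iexp (a i * \<xi> i)))"
    by (simp add: exp_sum sum_distrib_left)
  also have "\<dots> = (\<Prod>i<d. (CLINT x | std_normal_distribution. iexp (a i * x)))"
    by (intro gaussian_product.product_integral_prod N.integrable_const_bound[where B = 1]) auto
  also have "\<dots> = (\<Prod>i<d. complex_of_real (exp (- (a i)\<^sup>2 / 2)))"
    using char_std_normal_distribution by (simp add: char_def fun_eq_iff)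
  also have "\<dots> = complex_of_real (exp (- (\<Sum>i<d. (a i)\<^sup>2) / 2))"
    by (simp add: exp_sum[symmetric] sum_negf sum_divide_distrib flip: of_real_prod)
  finally show ?thesis .
qed

text \<open>By Fubini, the Gaussian average over \<open>\<xi>\<close> of the Fourier transform of
  \<open>u\<close> at \<open>s * \<xi>\<close> is the integral of \<open>u\<close> against the
  Gaussian characteristic function. Frequencies in a null set of directions do not affect this
  average, which is why vanishing in almost every direction suffices.\<close>

lemma gaussian_weight_vanishes:
  assumes u: "integrable (leb d) u"
    and van: "AE \<xi> in gaussian d. \<forall>s. (CLINT t | leb d. complex_of_real (u t) * iexp (s * (\<Sum>i<d. \<xi> i * t i))) = 0"
    and m: "m \<ge> 0"
  shows "(LINT t | leb d. u t * exp (- m * (\<Sum>i<d. (t i)\<^sup>2))) = 0"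
proof -
  interpret G: prob_space "gaussian d" by (rule prob_space_gaussian)
  interpret P: pair_sigma_finite "leb d" "gaussian d"
    using sigma_finite_leb G.sigma_finite_measure_axioms by (simp add: pair_sigma_finite_def)
  have [measurable]: "u \<in> borel_measurable (leb d)" using u by simp
  \<comment> \<open>With this scale \<open>exp (- s^2 |t|^2 / 2)\<close> becomes
    \<open>exp (- m |t|^2)\<close>.\<close>
  define s where "s = sqrt (2 * m)"
  let ?f = "\<lambda>t \<xi>. complex_of_real (u t) * iexp (s * (\<Sum>i<d. \<xi> i * t i))"
  have c: "(CLINT \<xi> | gaussian d. ?f t \<xi>) = complex_of_real (u t * exp (- m * (\<Sum>i<d. (t i)\<^sup>2)))" for t
  proof -
    have "(CLINT \<xi> | gaussian d. ?f t \<xi>) = complex_of_real (u t) * (CLINT \<xi> | gaussian d. iexp (\<Sum>i<d. s * t i * \<xi> i))"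
      by (simp add: sum_distrib_left mult_ac)
    also have "\<dots> = complex_of_real (u t * exp (- (\<Sum>i<d. (s * t i)\<^sup>2) / 2))"
      by (simp only: gaussian_char of_real_mult)
    also have "- (\<Sum>i<d. (s * t i)\<^sup>2) / 2 = - m * (\<Sum>i<d. (t i)\<^sup>2)"
      using m by (simp add: s_def power_mult_distrib sum_distrib_left[symmetric])
    finally show ?thesis .
  qed
  have [measurable]: "(\<lambda>(t, \<xi>). \<Sum>i<d. \<xi> i * t i :: real) \<in> borel_measurable (leb d \<Otimes>\<^sub>M gaussian d)"
    unfolding case_prod_beta
    by (intro borel_measurable_sum borel_measurable_times
          measurable_compose[OF measurable_fst measurable_leb_component]
          measurable_compose[OF measurable_snd measurable_gaussian_component]) auto
  have meas: "case_prod ?f \<in> borel_measurable (leb d \<Otimes>\<^sub>M gaussian d)"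
    by measurable
  \<comment> \<open>The phase has modulus 1 and \<open>gaussian d\<close> has total mass 1, so the
    norm integrates to that of \<open>u\<close>.\<close>
  have "integrable (leb d \<Otimes>\<^sub>M gaussian d) (case_prod ?f)"
  proof (rule P.Fubini_integrable[OF meas])
    show "integrable (leb d) (\<lambda>t. LINT \<xi>|gaussian d. norm (case_prod ?f (t, \<xi>)))"
      using u by (simp add: norm_mult G.prob_space)
    show "AE t in leb d. integrable (gaussian d) (\<lambda>\<xi>. case_prod ?f (t, \<xi>))"
      by (intro AE_I2 G.integrable_const_bound[where B = "norm (u _)"])
         (auto simp: norm_mult intro!: borel_measurable_times measurable_compose[OF _ borel_measurable_exp]
            borel_measurable_of_real)
  qed
  then have "(CLINT \<xi> | gaussian d. (CLINT t | leb d. ?f t \<xi>)) = (CLINT t | leb d. (CLINT \<xi> | gaussian d. ?f t \<xi>))"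
    by (rule P.Fubini_integral)
  moreover have "(CLINT \<xi> | gaussian d. (CLINT t | leb d. ?f t \<xi>)) = 0"
    using van by (intro integral_eq_zero_AE) auto
  ultimately have "complex_of_real (LINT t | leb d. u t * exp (- m * (\<Sum>i<d. (t i)\<^sup>2))) = 0"
    by (simp only: c integral_complex_of_real)
  then show ?thesis by (simp only: of_real_eq_0_iff)
qed

text \<open>Laplace's method: as \<open>m\<close> grows, the weight \<open>exp (- m |t|\<^sup>2)\<close> makes the neighbourhood of the origin
  on which \<open>u \<ge> c\<close> outweigh everything else.\<close>

lemma fourier_positive_False:
  assumes u: "integrable (leb d) u"
    and van: "AE \<xi> in gaussian d. \<forall>s. (CLINT t | leb d. complex_of_real (u t) * iexp (s * (\<Sum>i<d. \<xi> i * t i))) = 0"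
    and c: "c > 0" and \<delta>: "\<delta> > 0"
    and pos: "\<And>t. (\<Sum>i<d. (t i)\<^sup>2) < \<delta>\<^sup>2 \<Longrightarrow> u t \<ge> c"
  shows False
proof -
  \<comment> \<open>The cube of half side \<open>r\<close> then lies in the ball of radius
    \<open>\<delta> / 2\<close>, since \<open>d * r^2\<close> is at most
    \<open>((d + 1) * r)^2\<close>. The summand 1 avoids division by zero for
    \<open>d = 0\<close>.\<close>
  define r where "r = \<delta> / (2 * (d + 1))"
  have r: "r > 0" using \<delta> by (simp add: r_def)
  let ?Q = "Pi\<^sub>E {..<d} (\<lambda>_. {-r<..<r})"
  let ?q = "\<lambda>t. \<Sum>i<d. (t i :: real)\<^sup>2"
  have Q[measurable]: "?Q \<in> sets (leb d)" by (auto intro!: sets_PiM_I_finite)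
  have mQ: "measure (leb d) ?Q = (2 * r) ^ d" "emeasure (leb d) ?Q < \<infinity>"
    using r by (auto simp: measure_def emeasure_leb_box)
  have Qq: "?q t \<le> \<delta>\<^sup>2 / 4" if "t \<in> ?Q" for t
  proof -
    have "(t i)\<^sup>2 \<le> r\<^sup>2" if "i < d" for i
    proof (rule power2_le_iff_abs_le[THEN iffD2])
      show "\<bar>t i\<bar> \<le> r" using \<open>t \<in> ?Q\<close> that by (force simp: PiE_def Pi_def)
    qed (use r in auto)
    then have "?q t \<le> (\<Sum>i<d. r\<^sup>2)" by (intro sum_mono) auto
    also have "\<dots> = d * r\<^sup>2" by simp
    also have "\<dots> \<le> (d + 1)\<^sup>2 * r\<^sup>2"
      by (intro mult_right_mono) (auto simp: power2_eq_square)
    also have "\<dots> = ((d + 1) * r)\<^sup>2" by (simp add: power_mult_distrib)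
    also have "(d + 1) * r = \<delta> / 2" by (simp add: r_def field_simps)
    also have "(\<delta> / 2)\<^sup>2 = \<delta>\<^sup>2 / 4" by (simp add: power_divide)
    finally show ?thesis .
  qed
  define I where "I = (LINT t | leb d. \<bar>u t\<bar>)"
  have ineq: "c * (2 * r) ^ d \<le> exp (- (3 * \<delta>\<^sup>2 / 4) * m) * I" if m: "m \<ge> 0" for m
  proof -
    let ?g = "\<lambda>t. u t * exp (- m * ?q t)"
    \<comment> \<open>A lower bound for the weighted \<open>u\<close>: on the cube it keeps the
      guaranteed gain, elsewhere in the ball of radius \<open>\<delta>\<close> the integrand is
      nonnegative, and outside this ball the weight is at most
      \<open>exp (- m * \<delta>^2)\<close>.\<close>
    let ?h = "\<lambda>t. c * exp (- m * (\<delta>\<^sup>2 / 4)) * indicator ?Q t - exp (- m * \<delta>\<^sup>2) * \<bar>u t\<bar>"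
    have [measurable]: "u \<in> borel_measurable (leb d)" using u by simp
    have [measurable]: "?q \<in> borel_measurable (leb d)"
      by (intro borel_measurable_sum borel_measurable_power measurable_leb_component) auto
    have iQ: "integrable (leb d) (\<lambda>t. c * exp (- m * (\<delta>\<^sup>2 / 4)) * indicator ?Q t)"
      using mQ by (intro integrable_mult_right integrable_real_indicator) auto
    have iu: "integrable (leb d) (\<lambda>t. exp (- m * \<delta>\<^sup>2) * \<bar>u t\<bar>)" using u by simp
    have q0: "?q t \<ge> 0" for t by (intro sum_nonneg) auto
    have ig: "integrable (leb d) ?g"
    proof (rule Bochner_Integration.integrable_bound[OF u])
      show "AE t in leb d. norm (?g t) \<le> norm (u t)"
        using m q0 by (intro AE_I2) (auto simp: abs_mult intro!: mult_left_le)
    qed measurable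
    have "(LINT t | leb d. ?h t) \<le> (LINT t | leb d. ?g t)"
    proof (rule integral_mono)
      fix t
      show "?h t \<le> ?g t"
      proof (cases "?q t < \<delta>\<^sup>2")
        case True
        then have ut: "u t \<ge> c" by (rule pos)
        then have g0: "?g t \<ge> 0" using c by simp
        show ?thesis
        proof (cases "t \<in> ?Q")
          case True
          then have "exp (- m * (\<delta>\<^sup>2 / 4)) \<le> exp (- m * ?q t)"
            using mult_left_mono[OF Qq[OF True] m] by simp
          then have "c * exp (- m * (\<delta>\<^sup>2 / 4)) \<le> u t * exp (- m * ?q t)"
            using ut c by (intro mult_mono) auto
          moreover have "exp (- m * \<delta>\<^sup>2) * \<bar>u t\<bar> \<ge> 0" by simp
          moreover have ind: "indicator ?Q t = (1 :: real)" using True by simp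
          ultimately show ?thesis unfolding ind mult_1_right by linarith
        next
          case False
          then have ind: "indicator ?Q t = (0 :: real)" by simp
          have "exp (- m * \<delta>\<^sup>2) * \<bar>u t\<bar> \<ge> 0" by simp
          then show ?thesis using g0 unfolding ind mult_zero_right by linarith
        qed
      next
        case False
        have "\<delta>\<^sup>2 > 0" using \<delta> by simp
        then have "t \<notin> ?Q" using False Qq[of t] by linarith
        then have ind: "indicator ?Q t = (0 :: real)" by simp
        have "\<bar>?g t\<bar> \<le> exp (- m * \<delta>\<^sup>2) * \<bar>u t\<bar>"
          using False m by (auto simp: abs_mult mult.commute not_less intro!: mult_left_mono)
        then show ?thesis unfolding ind mult_zero_right by linarith
      qed
    qed (intro Bochner_Integration.integrable_diff iQ iu, rule ig)
    also have "\<dots> = 0" by (rule gaussian_weight_vanishes[OF u van m])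
    also have "(LINT t | leb d. ?h t) = c * exp (- m * (\<delta>\<^sup>2 / 4)) * (2 * r) ^ d - exp (- m * \<delta>\<^sup>2) * I"
      using mQ by (subst Bochner_Integration.integral_diff[OF iQ iu]) (simp add: I_def)
    finally have "c * (2 * r) ^ d * exp (- m * (\<delta>\<^sup>2 / 4)) \<le> exp (- m * \<delta>\<^sup>2) * I" by (simp add: mult_ac)
    then have "c * (2 * r) ^ d \<le> exp (- m * \<delta>\<^sup>2) * I / exp (- m * (\<delta>\<^sup>2 / 4))"
      by (simp add: pos_le_divide_eq)
    also have "\<dots> = exp (- (3 * \<delta>\<^sup>2 / 4) * m) * I"
    proof -
      have "- m * \<delta>\<^sup>2 = - (3 * \<delta>\<^sup>2 / 4) * m + - m * (\<delta>\<^sup>2 / 4)" by (simp add: algebra_simps)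
      then show ?thesis by (simp only: exp_add) simp
    qed
    finally show ?thesis .
  qed
  \<comment> \<open>The gain decays with rate \<open>\<delta>^2 / 4\<close>, the loss with rate
    \<open>\<delta>^2\<close>. After division the difference \<open>3 * \<delta>^2 / 4\<close>
    remains and drives the right-hand side to zero, while the left-hand side is a positive
    constant.\<close>
  have "((\<lambda>m. exp (- (3 * \<delta>\<^sup>2 / 4) * m) * I) \<longlongrightarrow> 0) at_top"
    using \<delta> by real_asymp
  moreover have "eventually (\<lambda>m. c * (2 * r) ^ d \<le> exp (- (3 * \<delta>\<^sup>2 / 4) * m) * I) at_top"
    using eventually_ge_at_top[of 0] by eventually_elim (rule ineq)
  ultimately have "c * (2 * r) ^ d \<le> 0"
    by (rule tendsto_lowerbound) simp
  moreover have "c * (2 * r) ^ d > 0" using c r by simp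
  ultimately show False by linarith
qed

section \<open>Slices of a plane\<close>

lemma orthonormal_upto_span_dim:
  assumes e: "orthonormal_upto d e"
  shows "dim (span (e ` {..<d})) = d"
proof -
  have inj: "inj_on e {..<d}"
    using e by (auto simp: orthonormal_upto_def inj_on_def) (metis zero_neq_one)
  have "independent (e ` {..<d})"
  proof (rule pairwise_orthogonal_independent)
    show "pairwise orthogonal (e ` {..<d})"
      using e by (auto simp: pairwise_def orthogonal_def orthonormal_upto_def)
    show "0 \<notin> e ` {..<d}"
      using e by (auto simp: orthonormal_upto_def) (metis inner_zero_left zero_neq_one)
  qed
  then show ?thesis using inj by (simp add: dim_eq_card_independent card_image)
qed

lemma orthonormal_upto_spans:
  assumes e: "orthonormal_upto d e" and W: "subspace W" "dim W = d" and sub: "\<And>i. i < d \<Longrightarrow> e i \<in> W"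
  shows "span (e ` {..<d}) = W"
proof (rule subspace_dim_equal)
  show "span (e ` {..<d}) \<subseteq> W" using W sub by (intro span_minimal) auto
qed (use W orthonormal_upto_span_dim[OF e] in auto)

text \<open>Supplies all frames below: \<open>V = {0}\<close> gives a basis of \<open>W\<close>
  itself, a line \<open>V\<close> gives the directions of a slice, and a hyperplane \<open>V\<close>
  of \<open>W\<close> gives its unit normal.\<close>

lemma orthonormal_complement:
  fixes V W :: "'a::euclidean_space set"
  assumes "subspace V" "subspace W" "V \<subseteq> W" "dim V + m = dim W"
  obtains c where "orthonormal_upto m c" "span (c ` {..<m}) = {w \<in> W. \<forall>v\<in>V. v \<bullet> w = 0}"
proof -
  let ?T = "{w \<in> W. \<forall>v\<in>V. orthogonal v w}"
  have T: "subspace ?T"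
    using assms by (auto simp: subspace_def orthogonal_def inner_add_right)
  have "dim ?T = m"
    using dim_subspace_orthogonal_to_vectors[OF assms(1-3)] assms(4) by simp
  obtain B where B: "B \<subseteq> ?T" "pairwise orthogonal B" "\<And>x. x \<in> B \<Longrightarrow> norm x = 1"
      "independent B" "card B = dim ?T" "span B = ?T"
    by (rule orthonormal_basis_subspace[OF T]) iprover
  have "finite B" using B(4) by (rule independent_imp_finite)
  then obtain c where c: "bij_betw c {0..<m} B"
    using ex_bij_betw_nat_finite[of B] B(5) \<open>dim ?T = m\<close> by auto
  have cB: "c ` {..<m} = B" using c by (simp add: bij_betw_def lessThan_atLeast0)
  have "orthonormal_upto m c"
    unfolding orthonormal_upto_def
  proof (intro allI impI)
    fix i j assume ij: "i < m" "j < m"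
    then have "c i \<in> B" "c j \<in> B" using cB by auto
    moreover have "i \<noteq> j \<Longrightarrow> c i \<noteq> c j"
      using c ij by (auto simp: bij_betw_def inj_on_def)
    ultimately show "c i \<bullet> c j = (if i = j then 1 else 0)"
      using B(2,3) by (auto simp: pairwise_def orthogonal_def norm_eq_1)
  qed
  then show ?thesis
    using that[of c] B(6) cB by (simp add: orthogonal_def)
qed

text \<open>The new vector takes the last index, so that the first \<open>k\<close> vectors of the
  extended frame still frame the slice orthogonal to it.\<close>

lemma orthonormal_upto_extend:
  assumes "orthonormal_upto k c" "norm w = 1" "\<And>i. i < k \<Longrightarrow> w \<bullet> c i = 0"
  shows "orthonormal_upto (Suc k) (c(k := w))"
  using assms by (auto simp: orthonormal_upto_def less_Suc_eq norm_eq_1 inner_commute)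

lemma plane_frame_span:
  "plane_frame d ((+) y ` W) y e \<longleftrightarrow> orthonormal_upto d e \<and> span (e ` {..<d}) = W"
proof -
  have range: "range (\<lambda>t. y + (\<Sum>i<d. t i *\<^sub>R e i)) = (+) y ` span (e ` {..<d})" if "orthonormal_upto d e"
    by (simp add: range_frame_map[OF that, symmetric] image_image frame_map_def)
  have inj: "(+) y ` W = (+) y ` span (e ` {..<d}) \<longleftrightarrow> W = span (e ` {..<d})"
    by (rule inj_image_eq_iff) simp
  have "plane_frame d ((+) y ` W) y e \<longleftrightarrow>
      orthonormal_upto d e \<and> (+) y ` W = range (\<lambda>t. y + (\<Sum>i<d. t i *\<^sub>R e i))"
    by (simp only: plane_frame_def orthonormal_upto_def)
  also have "\<dots> \<longleftrightarrow> orthonormal_upto d e \<and> (+) y ` W = (+) y ` span (e ` {..<d})"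
    by (rule conj_cong[OF refl]) (simp only: range)
  finally show ?thesis unfolding inj by blast
qed

lemma frame_map_Suc_upd: "frame_map (Suc k) e (t(k := s)) = frame_map k e t + s *\<^sub>R e k"
  by (simp add: frame_map_def)

section \<open>The Fourier slice formula\<close>

lemma radon_transform_slice:
  fixes f :: "real ^ 'n \<Rightarrow> real"
  assumes "continuous_on UNIV f" "orthonormal_upto k e"
  shows "radon_transform k f (range (\<lambda>t. p + frame_map k e t)) = (LINT t | leb k. f (p + frame_map k e t))"
proof -
  have [measurable]: "f \<in> borel_measurable borel" using assms(1) by (rule borel_measurable_continuous_onI)
  have "plane_frame k (range (\<lambda>t. p + frame_map k e t)) p e"
    using assms(2) by (simp add: plane_frame_def orthonormal_upto_def frame_map_def)
  from plane_measure_frame[OF this] show ?thesis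
    by (simp add: radon_transform_def integral_distr)
qed

text \<open>The new coordinate is integrated outermost. In the slice formula it is the position
  along the normal, and the inner integral runs over a slice.\<close>

lemma (in product_sigma_finite) product_integral_insert_rev:
  fixes f :: "_ \<Rightarrow> _::{banach, second_countable_topology}"
  assumes I: "finite I" "i \<notin> I"
    and f: "integrable (Pi\<^sub>M (insert i I) M) f"
  shows "integral\<^sup>L (Pi\<^sub>M (insert i I) M) f = (\<integral>y. (\<integral>x. f (x(i := y)) \<partial>Pi\<^sub>M I M) \<partial>M i)"
proof -
  interpret I: finite_product_sigma_finite M I by standard fact
  have [measurable]: "f \<in> borel_measurable (Pi\<^sub>M (insert i I) M)" using f by simp
  have "integral\<^sup>L (Pi\<^sub>M (insert i I) M) f = integral\<^sup>L (Pi\<^sub>M ({i} \<union> I) M) f" by simp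
  also have "\<dots> = (\<integral>x. (\<integral>y. f (merge {i} I (x, y)) \<partial>Pi\<^sub>M I M) \<partial>Pi\<^sub>M {i} M)"
    using f I by (intro product_integral_fold) auto
  also have "\<dots> = (\<integral>x. (\<integral>y. f (y(i := x i)) \<partial>Pi\<^sub>M I M) \<partial>Pi\<^sub>M {i} M)"
  proof (intro Bochner_Integration.integral_cong refl)
    fix x y assume "y \<in> space (Pi\<^sub>M I M)"
    then have "merge {i} I (x, y) = y(i := x i)"
      using I by (auto simp: merge_def fun_eq_iff space_PiM PiE_def extensional_def)
    then show "f (merge {i} I (x, y)) = f (y(i := x i))" by simp
  qed
  also have "\<dots> = (\<integral>y. (\<integral>x. f (x(i := y)) \<partial>Pi\<^sub>M I M) \<partial>M i)"
  proof (rule product_integral_singleton[where f = "\<lambda>y. \<integral>x. f (x(i := y)) \<partial>Pi\<^sub>M I M"])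
    have "(\<lambda>(y, x). f (x(i := y))) \<in> borel_measurable (M i \<Otimes>\<^sub>M Pi\<^sub>M I M)"
      by measurable
    then show "(\<lambda>y. \<integral>x. f (x(i := y)) \<partial>Pi\<^sub>M I M) \<in> borel_measurable (M i)"
      by (rule I.borel_measurable_lebesgue_integral)
  qed
  finally show ?thesis .
qed

text \<open>The plane is reparametrized by a frame whose last vector points along the frequency. The
  phase then depends on the last coordinate alone, and integrating out the others gives the Radon
  transform of a slice.\<close>

lemma fourier_slice:
  fixes f :: "real ^ 'n \<Rightarrow> real"
  assumes E: "orthonormal_upto (Suc k) E" and e: "orthonormal_upto (Suc k) e"
    and span: "span (E ` {..<Suc k}) = span (e ` {..<Suc k})"
    and f: "continuous_on UNIV f"
    and int: "integrable (leb (Suc k)) (\<lambda>t. f (y + frame_map (Suc k) E t))"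
    and \<zeta>: "\<zeta> = \<rho> *\<^sub>R e k"
  shows "(CLINT t | leb (Suc k). complex_of_real (f (y + frame_map (Suc k) E t)) * iexp (\<zeta> \<bullet> frame_map (Suc k) E t))
    = (CLINT s | lborel. iexp (\<rho> * s) * complex_of_real (radon_transform k f (range (\<lambda>t. y + s *\<^sub>R e k + frame_map k e t))))"
proof -
  have [measurable]: "f \<in> borel_measurable borel" using f by (rule borel_measurable_continuous_onI)
  define W where "W = span (e ` {..<Suc k})"
  have pf: "plane_frame (Suc k) ((+) y ` W) y E" "plane_frame (Suc k) ((+) y ` W) y e"
    unfolding plane_frame_span W_def using E e span by auto
  have dE: "distr (leb (Suc k)) borel (\<lambda>t. y + frame_map (Suc k) E t) = distr (leb (Suc k)) borel (\<lambda>t. y + frame_map (Suc k) e t)"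
    using plane_measure_frame[OF pf(1)] plane_measure_frame[OF pf(2)] by simp
  \<comment> \<open>The integrand has to be a function of the ambient point, so that equality of the
    two image measures applies to it.\<close>
  let ?F = "\<lambda>v. complex_of_real (f v) * iexp (\<zeta> \<bullet> (v - y))"
  have [measurable]: "?F \<in> borel_measurable borel" by measurable
  have int': "integrable (leb (Suc k)) (\<lambda>t. f (y + frame_map (Suc k) e t))"
    using int integrable_distr_eq[of "\<lambda>t. y + frame_map (Suc k) E t" "leb (Suc k)" borel f]
      integrable_distr_eq[of "\<lambda>t. y + frame_map (Suc k) e t" "leb (Suc k)" borel f]
    by (simp add: dE)
  have "(CLINT t | leb (Suc k). ?F (y + frame_map (Suc k) E t)) = (CLINT t | leb (Suc k). ?F (y + frame_map (Suc k) e t))"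
    using integral_distr[of "\<lambda>t. y + frame_map (Suc k) E t" "leb (Suc k)" borel ?F]
      integral_distr[of "\<lambda>t. y + frame_map (Suc k) e t" "leb (Suc k)" borel ?F]
    by (simp add: dE)
  also have "\<dots> = (CLINT t | leb (Suc k). complex_of_real (f (y + frame_map (Suc k) e t)) * iexp (\<rho> * t k))"
    using inner_frame_map[OF e, of k] by (simp add: \<zeta> inner_commute)
  also have "\<dots> = (CLINT t | PiM (insert k {..<k}) (\<lambda>_. lborel). complex_of_real (f (y + frame_map (Suc k) e t)) * iexp (\<rho> * t k))"
    by (simp add: lessThan_Suc)
  also have "\<dots> = (CLINT s | lborel. (CLINT t | leb k. complex_of_real (f (y + frame_map (Suc k) e (t(k := s)))) * iexp (\<rho> * (t(k := s)) k)))"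
  proof (rule lborel_product.product_integral_insert_rev)
    have "integrable (leb (Suc k)) (\<lambda>t. complex_of_real (f (y + frame_map (Suc k) e t)) * iexp (\<rho> * t k))"
      by (rule Bochner_Integration.integrable_bound[OF int']) (auto simp: norm_mult)
    then show "integrable (PiM (insert k {..<k}) (\<lambda>_. lborel)) (\<lambda>t. complex_of_real (f (y + frame_map (Suc k) e t)) * iexp (\<rho> * t k))"
      by (simp add: lessThan_Suc)
  qed auto
  also have "\<dots> = (CLINT s | lborel. iexp (\<rho> * s) * complex_of_real (LINT t | leb k. f (y + s *\<^sub>R e k + frame_map k e t)))"
    by (simp add: frame_map_Suc_upd add_ac mult.commute flip: integral_complex_of_real)
  also have "\<dots> = (CLINT s | lborel. iexp (\<rho> * s) * complex_of_real (radon_transform k f (range (\<lambda>t. y + s *\<^sub>R e k + frame_map k e t))))"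
  proof -
    have ek: "orthonormal_upto k e" using e by (simp add: orthonormal_upto_def)
    show ?thesis unfolding radon_transform_slice[OF f ek] ..
  qed
  finally show ?thesis by simp
qed

section \<open>Integrability on planes\<close>

text \<open>The half-line is handled by an antiderivative. Adding the reflected function dominates
  the integrand on the whole line, the doubled value at 0 being harmless.\<close>

lemma integrable_one_plus_abs_powr:
  assumes a: "a > (1::real)"
  shows "integrable lborel (\<lambda>x::real. (1 + \<bar>x\<bar>) powr (- a))"
proof -
  let ?f = "\<lambda>x::real. (1 + x) powr (- a)"
  let ?g = "\<lambda>x. ?f x * indicator {0..} x"
  have "(\<integral>\<^sup>+ x. ennreal (?f x) * indicator {0..} x \<partial>lborel) = ennreal (0 - (1 + 0) powr (1 - a) / (1 - a))"
  proof (rule nn_integral_FTC_atLeast)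
    show "((\<lambda>x. (1 + x) powr (1 - a) / (1 - a)) \<longlongrightarrow> 0) at_top" using a by real_asymp
    fix x :: real assume "0 \<le> x"
    then have "((\<lambda>x. x powr (1 - a)) has_real_derivative (1 - a) * (1 + x) powr (1 - a - 1)) (at (x + 1))"
      using has_real_derivative_powr[of "x + 1" "1 - a"] by (simp add: add.commute)
    then have "((\<lambda>x. (1 + x) powr (1 - a)) has_real_derivative (1 - a) * (1 + x) powr (- a)) (at x)"
      unfolding DERIV_shift by (simp add: add.commute)
    from DERIV_cdivide[OF this, of "1 - a"] a
    show "((\<lambda>x. (1 + x) powr (1 - a) / (1 - a)) has_real_derivative (1 + x) powr (- a)) (at x)"
      by simp
  qed auto
  then have "integrable lborel ?g"
    by (intro integrableI_bounded) (auto simp: abs_mult ennreal_mult' ennreal_indicator)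
  then have "integrable lborel ?g" "integrable lborel (\<lambda>x. ?g (- x))"
    using lborel_integrable_real_affine_iff[of "-1" ?g 0] by simp_all
  then have "integrable lborel (\<lambda>x. ?g x + ?g (- x))" by (rule Bochner_Integration.integrable_add)
  then show ?thesis
    by (rule Bochner_Integration.integrable_bound) (auto simp: indicator_def)
qed

text \<open>The little-o condition controls \<open>f\<close> outside a ball and compactness inside
  it. The weight in \<open>1 + norm v\<close> has no singularity at the origin, so one bound serves
  everywhere.\<close>

lemma decay_bound:
  fixes f :: "'a::euclidean_space \<Rightarrow> real"
  assumes f: "continuous_on UNIV f" and o: "f \<in> o[at_infinity](\<lambda>y. norm y powr (- N))" and N: "N > 0"
  obtains C where "C \<ge> 0" "\<And>v. \<bar>f v\<bar> \<le> C * (1 + norm v) powr (- N)"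
proof -
  have "eventually (\<lambda>v. norm (f v) \<le> 1 * norm (norm v powr (- N))) at_infinity"
    by (rule landau_o.smallD[OF o]) simp
  then obtain b where b: "\<And>v. norm v \<ge> b \<Longrightarrow> \<bar>f v\<bar> \<le> norm v powr (- N)"
    by (auto simp: eventually_at_infinity)
  define R where "R = max b 1"
  have R1: "R \<ge> 1" by (simp add: R_def)
  have "compact ((\<lambda>v. \<bar>f v\<bar>) ` cball 0 R)"
    using f by (intro compact_continuous_image continuous_intros) (auto intro: continuous_on_subset)
  then have "bounded ((\<lambda>v. \<bar>f v\<bar>) ` cball 0 R)" by (rule compact_imp_bounded)
  then obtain B where "\<forall>z \<in> (\<lambda>v. \<bar>f v\<bar>) ` cball 0 R. norm z \<le> B" unfolding bounded_iff by blast
  then have B: "\<And>v. norm v \<le> R \<Longrightarrow> \<bar>f v\<bar> \<le> B" by auto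
  have "\<bar>f 0\<bar> \<le> B" by (rule B) (simp add: R_def le_max_iff_disj)
  then have B0: "B \<ge> 0" by linarith
  \<comment> \<open>The first summand serves \<open>norm v \<le> R\<close>. The second serves the
    rest, where \<open>norm v \<ge> 1\<close> gives
    \<open>norm v \<ge> (1 + norm v) / 2\<close>.\<close>
  define C where "C = B * (1 + R) powr N + 2 powr N"
  have "\<bar>f v\<bar> \<le> C * (1 + norm v) powr (- N)" for v
  proof (cases "norm v \<le> R")
    case True
    have "1 \<le> ((1 + R) / (1 + norm v)) powr N"
      using True N by (intro ge_one_powr_ge_zero) (auto simp: pos_le_divide_eq add_pos_nonneg)
    also have "\<dots> = (1 + R) powr N * (1 + norm v) powr (- N)"
      using R1 by (subst powr_divide) (auto simp: powr_minus divide_inverse)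
    finally have "B * 1 \<le> B * ((1 + R) powr N * (1 + norm v) powr (- N))"
      using B0 by (intro mult_left_mono)
    also have "\<dots> \<le> C * (1 + norm v) powr (- N)"
      by (simp add: C_def algebra_simps)
    finally show ?thesis using B[OF True] by linarith
  next
    case False
    then have v: "norm v \<ge> b" "norm v \<ge> 1" by (auto simp: R_def)
    have "norm v powr (- N) \<le> ((1 + norm v) / 2) powr (- N)"
      using v N by (intro powr_mono2') auto
    also have "\<dots> = 2 powr N * (1 + norm v) powr (- N)"
      by (simp add: powr_divide powr_minus field_simps)
    also have "\<dots> \<le> C * (1 + norm v) powr (- N)"
      using B0 by (simp add: C_def algebra_simps)
    finally show ?thesis using b[OF v(1)] by linarith
  qed
  moreover have "C \<ge> 0" using B0 by (simp add: C_def)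
  ultimately show ?thesis using that by blast
qed

text \<open>Each coordinate is bounded by the norm, so the decay of order \<open>N\<close> can be
  shared equally among the \<open>d\<close> coordinates. The dominating function is a product of
  one-dimensional functions of exponent \<open>N / d > 1\<close>.\<close>

lemma integrable_frame:
  fixes f :: "'a::euclidean_space \<Rightarrow> real"
  assumes f: "continuous_on UNIV f" and o: "f \<in> o[at_infinity](\<lambda>y. norm y powr (- N))" and N: "N > real d"
    and d: "d > 0" and E: "orthonormal_upto d E"
  shows "integrable (leb d) (\<lambda>t. f (y + frame_map d E t))"
proof -
  have [measurable]: "f \<in> borel_measurable borel" using f by (rule borel_measurable_continuous_onI)
  obtain C where C: "C \<ge> 0" "\<And>v. \<bar>f v\<bar> \<le> C * (1 + norm v) powr (- N)"
    using decay_bound[OF f o] N by auto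
  have "integrable (leb d) (\<lambda>t. \<Prod>i<d. (1 + \<bar>t i\<bar>) powr (- (N / d)))"
    using N d by (intro lborel_product.product_integrable_prod integrable_one_plus_abs_powr)
      (auto simp: field_simps)
  then have "integrable (leb d) (\<lambda>t. (C * (1 + norm y) powr N) * (\<Prod>i<d. (1 + \<bar>t i\<bar>) powr (- (N / d))))"
    by (rule integrable_mult_right)
  then show ?thesis
  proof (rule Bochner_Integration.integrable_bound)
    show "AE t in leb d. norm (f (y + frame_map d E t))
        \<le> norm (C * (1 + norm y) powr N * (\<Prod>i<d. (1 + \<bar>t i\<bar>) powr (- (N / d))))"
    proof (rule AE_I2)
      fix t
      let ?v = "frame_map d E t"
      \<comment> \<open>Peetre's inequality: shifting the base point to \<open>y\<close> costs only
        the factor \<open>(1 + norm y) powr N\<close>.\<close>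
      have "1 + norm ?v \<le> (1 + norm y) * (1 + norm (y + ?v))"
      proof -
        have "norm ?v \<le> norm y + norm (y + ?v)"
          using norm_triangle_ineq4[of "y + ?v" y] by simp
        moreover have "norm y * norm (y + ?v) \<ge> 0" by simp
        ultimately show ?thesis by (simp only: ring_distribs mult_1 mult_1_right)
      qed
      then have "((1 + norm y) * (1 + norm (y + ?v))) powr (- N) \<le> (1 + norm ?v) powr (- N)"
        using N by (intro powr_mono2') (auto intro: add_pos_nonneg)
      then have "(1 + norm y) powr N * ((1 + norm y) * (1 + norm (y + ?v))) powr (- N)
          \<le> (1 + norm y) powr N * (1 + norm ?v) powr (- N)"
        by (intro mult_left_mono) auto
      moreover have "(1 + norm y) powr N * ((1 + norm y) * (1 + norm (y + ?v))) powr (- N) = (1 + norm (y + ?v)) powr (- N)"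
      proof -
        have "1 + norm y > 0" by (simp add: add_pos_nonneg)
        then show ?thesis by (subst powr_mult) (auto simp: powr_minus)
      qed
      ultimately have 1: "(1 + norm (y + ?v)) powr (- N) \<le> (1 + norm y) powr N * (1 + norm ?v) powr (- N)"
        by simp
      have "(1 + norm ?v) powr (- N) = (\<Prod>i<d. (1 + norm ?v) powr (- (N / d)))"
        using d by (simp flip: powr_realpow' powr_realpow) (simp add: powr_powr powr_power add_pos_nonneg)
      also have "\<dots> \<le> (\<Prod>i<d. (1 + \<bar>t i\<bar>) powr (- (N / d)))"
      proof (rule prod_mono, intro conjI)
        fix i assume "i \<in> {..<d}"
        then have "\<bar>t i\<bar> \<le> norm ?v"
          using Cauchy_Schwarz_ineq2[of ?v "E i"] inner_frame_map[OF E, of i t] E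
          by (simp add: orthonormal_upto_def norm_eq_1[THEN iffD2])
        then show "(1 + norm ?v) powr (- (N / d)) \<le> (1 + \<bar>t i\<bar>) powr (- (N / d))"
          using N d by (intro powr_mono2') auto
      qed auto
      finally have 2: "(1 + norm ?v) powr (- N) \<le> (\<Prod>i<d. (1 + \<bar>t i\<bar>) powr (- (N / d)))" .
      have "\<bar>f (y + ?v)\<bar> \<le> C * (1 + norm (y + ?v)) powr (- N)" by (rule C)
      also have "\<dots> \<le> C * ((1 + norm y) powr N * (\<Prod>i<d. (1 + \<bar>t i\<bar>) powr (- (N / d))))"
        using 1 mult_left_mono[OF 2, of "(1 + norm y) powr N"] C(1) by (intro mult_left_mono) auto
      finally show "norm (f (y + ?v)) \<le> norm (C * (1 + norm y) powr N * (\<Prod>i<d. (1 + \<bar>t i\<bar>) powr (- (N / d))))"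
        by (simp add: mult.assoc)
    qed
  qed measurable
qed

section \<open>Slices in the family\<close>

lemma affine_hull_base:
  assumes "a \<in> X"
  shows "affine hull X = (+) a ` span ((+) (- a) ` X)"
  using affine_hull_span_gen[of a X] assms by (simp add: hull_inc)

text \<open>The slice with normal \<open>e k\<close> at height
  \<open>r = s + y \<bullet> e k\<close> is the plane of the family belonging to its point
  \<open>q + r e k\<close>. The vector \<open>\<nu>\<close>, normal to \<open>D\<close> in
  \<open>W\<close>, expresses that \<open>e k\<close> is not parallel to \<open>D\<close>, so this
  point runs into the excluded sets for only finitely many \<open>s\<close>.\<close>

lemma slice_in_plane_family:
  fixes x :: "nat \<Rightarrow> real ^ 'n" and k :: nat
  defines "a \<equiv> x (k + 1)"
  defines "D \<equiv> span ((+) (- a) ` x ` {1..k + 1})"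
  assumes dimD: "dim D = k" and W: "subspace W" "dim W = Suc k" "D \<subseteq> W"
    and e: "orthonormal_upto (Suc k) e" "span (e ` {..<Suc k}) = W"
    and y: "y - a \<in> W" and \<nu>: "\<And>v. v \<in> D \<Longrightarrow> \<nu> \<bullet> v = 0" "\<nu> \<in> W" "\<nu> \<bullet> e k \<noteq> 0"
  shows "AE s in lborel. range (\<lambda>t. y + s *\<^sub>R e k + frame_map k e t) \<in> plane_family k x"
proof -
  let ?\<omega> = "e k" and ?X = "x ` {1..k + 1}"
  have aX: "a \<in> ?X" by (auto simp: a_def)
  have eW: "e i \<in> W" if "i \<le> k" for i using e(2) that by (auto intro: span_base)
  \<comment> \<open>The component of \<open>a\<close> orthogonal to \<open>W\<close>, which is the
    point of \<open>a + W\<close> nearest to the origin.\<close>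
  define q where "q = a - frame_map (Suc k) e (\<lambda>i. a \<bullet> e i)"
  have qe: "q \<bullet> e i = 0" if "i \<le> k" for i
    using inner_frame_map[OF e(1), of i] that by (simp add: q_def inner_diff_left)
  have qW: "q \<bullet> w = 0" if "w \<in> W" for w
  proof -
    have "w = frame_map (Suc k) e (\<lambda>i. w \<bullet> e i)" using frame_map_coords[OF e(1)] that e(2) by simp
    also have "q \<bullet> \<dots> = 0" by (simp add: frame_map_def inner_sum_right qe del: sum.lessThan_Suc)
    finally show ?thesis .
  qed
  have qa: "q - a \<in> W"
    using frame_map_in_span[of "Suc k" e "\<lambda>i. a \<bullet> e i"] e(2) W(1) by (simp add: q_def subspace_neg)
  have \<omega>\<omega>: "?\<omega> \<bullet> ?\<omega> = 1" using e(1) by (simp add: orthonormal_upto_def)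
  \<comment> \<open>The first two conditions keep \<open>x0\<close> out of \<open>U_set\<close>, by
    its equation for the index \<open>k + 1\<close>. The third keeps it out of the affine hull,
    because \<open>\<nu>\<close> is not orthogonal to \<open>x0 - a\<close>.\<close>
  have in_fam: "range (\<lambda>t. y + s *\<^sub>R ?\<omega> + frame_map k e t) \<in> plane_family k x"
    if s: "s + y \<bullet> ?\<omega> \<noteq> 0" "s + y \<bullet> ?\<omega> \<noteq> a \<bullet> ?\<omega>" "(s + y \<bullet> ?\<omega>) * (\<nu> \<bullet> ?\<omega>) \<noteq> a \<bullet> \<nu>" for s
  proof -
    define r where "r = s + y \<bullet> ?\<omega>"
    define x0 where "x0 = q + r *\<^sub>R ?\<omega>"
    have x0W: "x0 - a \<in> W"
      using subspace_add[OF W(1) qa subspace_scale[OF W(1) eW[of k], of r]] by (simp add: x0_def algebra_simps)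
    have x0\<nu>: "\<nu> \<bullet> (x0 - a) \<noteq> 0"
      using s(3) qW[OF \<nu>(2)] by (simp add: x0_def r_def inner_simps inner_commute mult.commute)
    then have x0D: "x0 - a \<notin> D" using \<nu>(1) by blast
    then have x0H: "x0 \<notin> affine hull ?X"
      unfolding affine_hull_base[OF aX] D_def[symmetric] by auto
    have "(x0 - a) \<bullet> x0 = r * (r - a \<bullet> ?\<omega>)"
    proof -
      have "x0 \<bullet> x0 = q \<bullet> q + r * r"
        using qe[of k] \<omega>\<omega> by (simp add: x0_def inner_simps inner_commute)
      moreover have "a \<bullet> x0 = q \<bullet> q + r * (a \<bullet> ?\<omega>)"
        using qW[OF qa] by (simp add: x0_def inner_simps inner_commute)
      ultimately show ?thesis by (simp add: inner_diff_left algebra_simps)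
    qed
    then have "(x0 - x (k + 1)) \<bullet> x0 \<noteq> 0" using s by (simp add: a_def r_def)
    then have x0U: "x0 \<notin> U_set k x" unfolding U_set_def by (auto intro!: bexI[of _ "k + 1"])
    have aff: "affine hull (insert x0 ?X) = (+) a ` W"
    proof -
      have "affine hull (insert x0 ?X) = (+) a ` span (insert (x0 - a) ((+) (- a) ` ?X))"
        using affine_hull_base[of a "insert x0 ?X"] aX by simp
      also have "span (insert (x0 - a) ((+) (- a) ` ?X)) = W" (is "?S = W")
      proof (rule subspace_dim_equal)
        have "(+) (- a) ` ?X \<subseteq> D" unfolding D_def by (rule span_superset)
        then have "(+) (- a) ` ?X \<subseteq> W" using W(3) by (rule subset_trans)
        then show "?S \<subseteq> W" using x0W W(1) by (intro span_minimal) auto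
        have "dim (insert (x0 - a) ((+) (- a) ` ?X)) = Suc k"
          using x0D dimD unfolding D_def by (simp add: dim_insert)
        then show "dim W \<le> dim ?S" using W(2) by simp
      qed (use W in auto)
      finally show ?thesis .
    qed
    have "range (\<lambda>t. y + s *\<^sub>R ?\<omega> + frame_map k e t) = (+) a ` W \<inter> foot_hyperplane x0"
    proof -
      \<comment> \<open>Since \<open>q\<close> is orthogonal to \<open>W\<close>, the equation of
        the hyperplane becomes \<open>r * (v \<bullet> e k - r) = 0\<close> on \<open>a + W\<close>,
        and \<open>r\<close> is nonzero.\<close>
      have foot: "v \<in> foot_hyperplane x0 \<longleftrightarrow> v \<bullet> ?\<omega> = r" if "v - a \<in> W" for v
      proof -
        have "v - q \<in> W" using subspace_diff[OF W(1) that qa] by simp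
        then have "q \<bullet> (v - q) = 0" by (rule qW)
        then have "(v - x0) \<bullet> x0 = r * (v \<bullet> ?\<omega> - r)"
          using qe[of k] \<omega>\<omega> by (simp add: x0_def inner_simps inner_commute algebra_simps)
        then show ?thesis using s(1) by (simp add: foot_hyperplane_def r_def)
      qed
      have "y + s *\<^sub>R ?\<omega> + frame_map k e t - a \<in> W" for t
      proof -
        have "frame_map k e t \<in> W"
          unfolding frame_map_def by (intro subspace_sum subspace_scale W(1) eW) auto
        then have "(y - a) + (s *\<^sub>R ?\<omega> + frame_map k e t) \<in> W"
          using y eW[of k] W(1) by (intro subspace_add subspace_scale) auto
        then show ?thesis by (simp add: algebra_simps)
      qed
      moreover have "(y + s *\<^sub>R ?\<omega> + frame_map k e t) \<bullet> ?\<omega> = r" for t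
      proof -
        have "frame_map k e t \<bullet> ?\<omega> = 0"
          using e(1) by (simp add: frame_map_def inner_sum_left orthonormal_upto_def)
        then show ?thesis by (simp add: inner_simps \<omega>\<omega> r_def)
      qed
      moreover have "v \<in> range (\<lambda>t. y + s *\<^sub>R ?\<omega> + frame_map k e t)"
        if "v - a \<in> W" "v \<bullet> ?\<omega> = r" for v
      proof -
        \<comment> \<open>This vector of \<open>W\<close> has last coordinate 0, so the first
          \<open>k\<close> frame vectors already express it.\<close>
        define u where "u = v - y - s *\<^sub>R ?\<omega>"
        have "(v - a) - (y - a) - s *\<^sub>R ?\<omega> \<in> W"
          by (intro subspace_diff subspace_scale W(1) that(1) y eW) simp
        then have "u \<in> W" by (simp add: u_def)
        then have "u = frame_map (Suc k) e (\<lambda>i. u \<bullet> e i)" using frame_map_coords[OF e(1)] e(2) by simp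
        moreover have "u \<bullet> ?\<omega> = 0" using that(2) by (simp add: u_def inner_simps \<omega>\<omega> r_def)
        ultimately have "u = frame_map k e (\<lambda>i. u \<bullet> e i)" by (simp add: frame_map_def)
        moreover have "v = y + s *\<^sub>R ?\<omega> + u" by (simp add: u_def)
        ultimately show ?thesis by (metis rangeI)
      qed
      moreover have "v \<in> (+) a ` W \<longleftrightarrow> v - a \<in> W" for v
        by (metis diff_add_cancel image_iff add_diff_cancel_left')
      ultimately show ?thesis using foot by blast
    qed
    also have "\<dots> = Sigma_plane k x x0" unfolding Sigma_plane_def aff ..
    finally show ?thesis using x0H x0U unfolding plane_family_def by blast
  qed
  \<comment> \<open>The three forbidden heights, expressed in \<open>s\<close> instead of
    \<open>r\<close>.\<close>
  let ?B = "{- (y \<bullet> ?\<omega>), a \<bullet> ?\<omega> - y \<bullet> ?\<omega>, (a \<bullet> \<nu>) / (\<nu> \<bullet> ?\<omega>) - y \<bullet> ?\<omega>}"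
  have "AE s in lborel. s \<notin> ?B"
    by (rule AE_not_in) (simp add: finite_imp_null_set_lborel)
  then show ?thesis
  proof eventually_elim
    case (elim s)
    then show ?case using \<nu>(3) by (intro in_fam) (auto simp: field_simps)
  qed
qed

text \<open>The two generating sets differ only in signs and in the zero vector contributed by the
  index \<open>k + 1\<close>.\<close>

lemma general_position_dim:
  fixes x :: "nat \<Rightarrow> real ^ 'n"
  assumes "general_position k x"
  shows "dim (span ((+) (- x (k + 1)) ` x ` {1..k + 1})) = k"
proof -
  let ?B = "(\<lambda>i. x (k + 1) - x i) ` {1..k}"
  have "span ((+) (- x (k + 1)) ` x ` {1..k + 1}) = span ?B"
  proof (rule span_eq[THEN iffD2], intro conjI subsetI)
    fix v assume "v \<in> (+) (- x (k + 1)) ` x ` {1..k + 1}"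
    then obtain i where i: "i \<in> {1..k + 1}" "v = - (x (k + 1) - x i)" by auto
    show "v \<in> span ?B"
    proof (cases "i = k + 1")
      case False
      then have "x (k + 1) - x i \<in> ?B" using i(1) by auto
      then show ?thesis unfolding i(2) by (intro span_neg span_base)
    qed (use i in \<open>simp add: span_zero\<close>)
  next
    fix v assume "v \<in> ?B"
    then obtain i where i: "i \<in> {1..k}" "v = - (- x (k + 1) + x i)" by auto
    have "- x (k + 1) + x i \<in> (+) (- x (k + 1)) ` x ` {1..k + 1}" using i(1) by auto
    then show "v \<in> span ((+) (- x (k + 1)) ` x ` {1..k + 1})" unfolding i(2) by (intro span_neg span_base)
  qed
  moreover have "dim (span ?B) = card ?B"
    using assms by (simp add: general_position_def dim_eq_card_independent)
  moreover have "card ?B = k" using assms by (simp add: general_position_def card_image)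
  ultimately show ?thesis by simp
qed

section \<open>Recovery of a function value from the family\<close>

lemma borel_measurable_radon_transform_slice:
  fixes f :: "real ^ 'n \<Rightarrow> real"
  assumes "continuous_on UNIV f" "orthonormal_upto k e"
  shows "(\<lambda>s. radon_transform k f (range (\<lambda>t. y + s *\<^sub>R w + frame_map k e t))) \<in> borel_measurable lborel"
proof -
  interpret L: sigma_finite_measure "leb k" by (rule sigma_finite_leb)
  have [measurable]: "f \<in> borel_measurable borel" using assms(1) by (rule borel_measurable_continuous_onI)
  have "(\<lambda>(s, t). f (y + s *\<^sub>R w + frame_map k e t)) \<in> borel_measurable (lborel \<Otimes>\<^sub>M leb k)"
    by measurable
  then show ?thesis
    unfolding radon_transform_slice[OF assms] by (rule L.borel_measurable_lebesgue_integral)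
qed

text \<open>If \<open>g y\<close> were positive, continuity would keep \<open>g\<close> above
  \<open>g y / 2\<close> near \<open>y\<close>, which \<open>fourier_positive_False\<close> rules
  out. The same argument for \<open>- g\<close> excludes a negative value.\<close>

lemma fourier_zero:
  fixes g :: "'a::euclidean_space \<Rightarrow> real"
  assumes g: "continuous_on UNIV g" and E: "orthonormal_upto d E"
    and int: "integrable (leb d) (\<lambda>t. g (y + frame_map d E t))"
    and van: "AE \<xi> in gaussian d. \<forall>s. (CLINT t | leb d. complex_of_real (g (y + frame_map d E t)) * iexp (s * (\<Sum>i<d. \<xi> i * t i))) = 0"
  shows "g y = 0"
proof -
  have aux: "h y \<le> 0"
    if h: "continuous_on UNIV h" "integrable (leb d) (\<lambda>t. h (y + frame_map d E t))"
      and v: "AE \<xi> in gaussian d. \<forall>s. (CLINT t | leb d. complex_of_real (h (y + frame_map d E t)) * iexp (s * (\<Sum>i<d. \<xi> i * t i))) = 0"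
    for h
  proof (rule ccontr)
    assume "\<not> h y \<le> 0"
    then have c: "h y / 2 > 0" by simp
    then obtain \<delta> where \<delta>: "\<delta> > 0" "\<And>w. dist w y < \<delta> \<Longrightarrow> dist (h w) (h y) < h y / 2"
      using h(1) unfolding continuous_on_iff by (metis UNIV_I)
    show False
    proof (rule fourier_positive_False[OF h(2) v c \<delta>(1)])
      fix t assume "(\<Sum>i<d. (t i)\<^sup>2) < \<delta>\<^sup>2"
      then have "norm (frame_map d E t) < \<delta>"
        using norm_frame_map[OF E, of t] \<delta>(1) by (metis power2_less_imp_less less_imp_le)
      then have "dist (h (y + frame_map d E t)) (h y) < h y / 2" by (intro \<delta>(2)) (simp add: dist_norm)
      then show "h y / 2 \<le> h (y + frame_map d E t)" unfolding dist_real_def by linarith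
    qed
  qed
  have "g y \<le> 0" by (rule aux[OF g int van])
  moreover have "- g y \<le> 0"
    using van by (intro aux[of "\<lambda>v. - g v"]) (use g int in \<open>auto intro!: continuous_intros\<close>)
  ultimately show ?thesis by simp
qed

text \<open>In the frame used below the last coordinate is the component normal to \<open>D\<close>,
  so almost every frequency has a direction that is not parallel to \<open>D\<close>.\<close>

lemma AE_gaussian_component_nonzero:
  assumes "i < d"
  shows "AE \<xi> in gaussian d. \<xi> i \<noteq> 0"
proof (rule AE_PiM_component)
  show "AE v in std_normal_distribution. v \<noteq> 0"
    using AE_lborel_singleton[of "0 :: real"] by (auto simp: AE_density elim: eventually_mono)
qed (use assms prob_space_std_normal in auto)

text \<open>By \<open>fourier_slice\<close> both transforms are one-dimensional integrals of Radon
  transforms over slices orthogonal to the frequency. As \<open>\<xi> k\<close> is nonzero, almost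
  all of these slices belong to the family, where the two Radon transforms agree.\<close>

lemma fourier_determined_by_slices:
  fixes f1 f2 :: "real ^ 'n \<Rightarrow> real" and x :: "nat \<Rightarrow> real ^ 'n" and k :: nat
  defines "a \<equiv> x (k + 1)"
  defines "D \<equiv> span ((+) (- a) ` x ` {1..k + 1})"
  assumes dimD: "dim D = k" and W: "subspace W" "dim W = Suc k" "D \<subseteq> W"
    and E: "orthonormal_upto (Suc k) E" "span (E ` {..<Suc k}) = W"
    and y: "y - a \<in> W" and Ek: "\<And>v. v \<in> D \<Longrightarrow> E k \<bullet> v = 0"
    and f: "continuous_on UNIV f1" "continuous_on UNIV f2"
    and int: "integrable (leb (Suc k)) (\<lambda>t. f1 (y + frame_map (Suc k) E t))"
      "integrable (leb (Suc k)) (\<lambda>t. f2 (y + frame_map (Suc k) E t))"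
    and eq: "\<And>S. S \<in> plane_family k x \<Longrightarrow> radon_transform k f1 S = radon_transform k f2 S"
    and \<xi>: "\<xi> k \<noteq> 0"
  shows "(CLINT t | leb (Suc k). complex_of_real (f1 (y + frame_map (Suc k) E t)) * iexp (s * (\<Sum>i<Suc k. \<xi> i * t i)))
    = (CLINT t | leb (Suc k). complex_of_real (f2 (y + frame_map (Suc k) E t)) * iexp (s * (\<Sum>i<Suc k. \<xi> i * t i)))"
proof -
  \<comment> \<open>The frequency as a vector of \<open>W\<close>; its component along the normal
    \<open>E k\<close> of \<open>D\<close> is \<open>\<xi> k\<close>.\<close>
  define u where "u = frame_map (Suc k) E \<xi>"
  have uW: "u \<in> W" using frame_map_in_span[of "Suc k" E \<xi>] E(2) by (simp add: u_def)
  have uE: "u \<bullet> E k = \<xi> k" unfolding u_def by (rule inner_frame_map[OF E(1)]) simp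
  then have u0: "u \<noteq> 0" using \<xi> by auto
  define \<omega> where "\<omega> = u /\<^sub>R norm u"
  have \<omega>: "norm \<omega> = 1" "\<omega> \<in> W" "\<omega> \<noteq> 0" "u = norm u *\<^sub>R \<omega>"
    using u0 uW W(1) by (auto simp: \<omega>_def subspace_scale)
  have "dim (span {\<omega>}) + k = dim W" using \<omega>(3) W(2) by (simp add: dim_insert)
  moreover have "span {\<omega>} \<subseteq> W" using \<omega>(2) W(1) by (intro span_minimal) auto
  ultimately obtain b where b: "orthonormal_upto k b"
      "span (b ` {..<k}) = {w \<in> W. \<forall>v\<in>span {\<omega>}. v \<bullet> w = 0}"
    using orthonormal_complement[of "span {\<omega>}" W k] W(1) by auto
  have bW: "b i \<in> W" "\<omega> \<bullet> b i = 0" if "i < k" for i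
  proof -
    have "b i \<in> span (b ` {..<k})" using that by (auto intro: span_base)
    then show "b i \<in> W" "\<omega> \<bullet> b i = 0" unfolding b(2) by (auto intro: span_base)
  qed
  \<comment> \<open>A second frame of \<open>W\<close>, adapted to the frequency: \<open>b\<close>
    spans the slices and the last vector is their normal.\<close>
  define e where "e = b(k := \<omega>)"
  have e: "orthonormal_upto (Suc k) e"
    unfolding e_def using b(1) \<omega>(1) bW(2) by (rule orthonormal_upto_extend)
  have eW: "span (e ` {..<Suc k}) = W"
    using bW(1) \<omega>(2) by (intro orthonormal_upto_spans[OF e W(1,2)]) (auto simp: e_def less_Suc_eq)
  have ek: "e k = \<omega>" by (simp add: e_def)
  have e': "orthonormal_upto k e" using e by (simp add: orthonormal_upto_def)
  have EW: "E k \<in> W" unfolding E(2)[symmetric] by (intro span_base) auto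
  have "E k \<bullet> e k \<noteq> 0" using uE \<xi> u0 by (simp add: ek \<omega>_def inner_commute)
  then have fam: "AE s in lborel. range (\<lambda>t. y + s *\<^sub>R e k + frame_map k e t) \<in> plane_family k x"
    using slice_in_plane_family[of x k W e y "E k"] dimD W e eW y Ek EW
    unfolding D_def a_def by blast
  have \<zeta>: "s *\<^sub>R u = (s * norm u) *\<^sub>R e k" using arg_cong[OF \<omega>(4), of "(*\<^sub>R) s"] by (simp only: ek scaleR_scaleR)
  have ph: "s * (\<Sum>i<Suc k. \<xi> i * t i) = (s *\<^sub>R u) \<bullet> frame_map (Suc k) E t" for t
  proof -
    have "u \<bullet> frame_map (Suc k) E t = (\<Sum>i<Suc k. t i * (u \<bullet> E i))"
      by (subst frame_map_def) (simp add: inner_sum_right inner_add_right del: sum.lessThan_Suc)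
    also have "\<dots> = (\<Sum>i<Suc k. \<xi> i * t i)"
      unfolding u_def by (intro sum.cong) (auto simp: inner_frame_map[OF E(1)])
    finally show ?thesis by simp
  qed
  have sp: "span (E ` {..<Suc k}) = span (e ` {..<Suc k})" using E(2) eW by simp
  have meas: "(\<lambda>r. iexp (s * norm u * r) * complex_of_real (radon_transform k f (range (\<lambda>t. y + r *\<^sub>R e k + frame_map k e t)))) \<in> borel_measurable lborel"
    if "continuous_on UNIV f" for f :: "real ^ 'n \<Rightarrow> real"
  proof -
    note borel_measurable_radon_transform_slice[OF that e', measurable]
    show ?thesis by measurable
  qed
  show ?thesis
    unfolding ph fourier_slice[OF E(1) e sp f(1) int(1) \<zeta>] fourier_slice[OF E(1) e sp f(2) int(2) \<zeta>]
  proof (rule integral_cong_AE)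
    show "AE r in lborel. iexp (s * norm u * r) * complex_of_real (radon_transform k f1 (range (\<lambda>t. y + r *\<^sub>R e k + frame_map k e t)))
        = iexp (s * norm u * r) * complex_of_real (radon_transform k f2 (range (\<lambda>t. y + r *\<^sub>R e k + frame_map k e t)))"
      using fam by eventually_elim (simp only: eq)
  qed (intro meas f)+
qed

text \<open>A \<open>(k + 1)\<close>-plane through \<open>y\<close> and the given points is chosen.
  On it the Fourier transform of \<open>f1 - f2\<close> vanishes in almost every direction, and
  \<open>fourier_zero\<close> applies at \<open>y\<close>.\<close>

lemma eq_at_if_radon_eq_on_family:
  fixes f1 f2 :: "real ^ 'n \<Rightarrow> real" and x :: "nat \<Rightarrow> real ^ 'n"
  assumes k: "k < CARD('n)" and gp: "general_position k x" and N: "N > real k + 1"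
    and f: "continuous_on UNIV f1" "continuous_on UNIV f2"
    and o: "f1 \<in> o[at_infinity](\<lambda>y. norm y powr (- N))" "f2 \<in> o[at_infinity](\<lambda>y. norm y powr (- N))"
    and eq: "\<And>S. S \<in> plane_family k x \<Longrightarrow> radon_transform k f1 S = radon_transform k f2 S"
  shows "f1 y = f2 y"
proof -
  define a where "a = x (k + 1)"
  define D where "D = span ((+) (- a) ` x ` {1..k + 1})"
  have dimD: "dim D = k" using general_position_dim[OF gp] by (simp add: D_def a_def)
  have D: "subspace D" "span D = D" by (auto simp: D_def)
  \<comment> \<open>If \<open>y\<close> lies off the affine hull of the given points,
    \<open>y - a\<close> is the missing direction. Otherwise any vector outside \<open>D\<close>
    will do, and one exists because \<open>k\<close> is less than the dimension of the
    space.\<close>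
  obtain w where w: "w \<notin> D" "y - a \<in> span (insert w D)"
  proof (cases "y - a \<in> D")
    case True
    have "D \<noteq> UNIV" using dimD k by (metis dim_UNIV DIM_cart DIM_real mult.right_neutral less_irrefl)
    then obtain w where "w \<notin> D" by auto
    moreover have "y - a \<in> span (insert w D)" using True by (intro span_base) auto
    ultimately show ?thesis by (rule that)
  next
    case False
    then show ?thesis by (rule that) (intro span_base, simp)
  qed
  define W where "W = span (insert w D)"
  have "dim W = Suc k" unfolding W_def dim_span dim_insert D(2) using w(1) dimD by simp
  then have W: "subspace W" "dim W = Suc k" "D \<subseteq> W"
    by (auto simp: W_def intro: span_base)
  obtain c where c: "orthonormal_upto k c" "span (c ` {..<k}) = D"
    using orthonormal_complement[of "{0}" D k] D(1) dimD by (auto simp: subspace_0)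
  obtain n where n: "orthonormal_upto 1 n" "span (n ` {..<1}) = {w \<in> W. \<forall>v\<in>D. v \<bullet> w = 0}"
    using orthonormal_complement[OF D(1) W(1) W(3), of 1] dimD W(2) by auto
  have "n 0 \<in> span (n ` {..<1})" by (intro span_base) auto
  then have n0: "n 0 \<in> W" "\<And>v. v \<in> D \<Longrightarrow> n 0 \<bullet> v = 0" unfolding n(2) by (auto simp: inner_commute)
  have cD: "c i \<in> D" if "i < k" for i unfolding c(2)[symmetric] using that by (intro span_base) auto
  \<comment> \<open>The last vector is the unit normal of \<open>D\<close> in \<open>W\<close>, so
    the last coordinate of a frequency tests whether it is parallel to \<open>D\<close>.\<close>
  define E where "E = c(k := n 0)"
  have E: "orthonormal_upto (Suc k) E"
    unfolding E_def
    using c(1) n(1) n0(2) cD by (intro orthonormal_upto_extend) (auto simp: orthonormal_upto_def norm_eq_1)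
  have EW: "span (E ` {..<Suc k}) = W"
    using W(3) n0(1) cD by (intro orthonormal_upto_spans[OF E W(1,2)]) (auto simp: E_def less_Suc_eq)
  have EkD: "E k \<bullet> v = 0" if "v \<in> D" for v using n0(2)[OF that] by (simp add: E_def)
  have ya: "y - a \<in> W" using w(2) by (simp add: W_def)
  have int: "integrable (leb (Suc k)) (\<lambda>t. f1 (y + frame_map (Suc k) E t))"
      "integrable (leb (Suc k)) (\<lambda>t. f2 (y + frame_map (Suc k) E t))"
    using N integrable_frame[OF f(1) o(1) _ _ E] integrable_frame[OF f(2) o(2) _ _ E] by simp_all
  let ?F = "\<lambda>f s \<xi>. CLINT t | leb (Suc k). complex_of_real (f (y + frame_map (Suc k) E t)) * iexp (s * (\<Sum>i<Suc k. \<xi> i * t i))"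
  have cint: "integrable (leb (Suc k)) (\<lambda>t. complex_of_real (f (y + frame_map (Suc k) E t)) * iexp (s * (\<Sum>i<Suc k. \<xi> i * t i)))"
    if "continuous_on UNIV f" "integrable (leb (Suc k)) (\<lambda>t. f (y + frame_map (Suc k) E t))" for f s and \<xi> :: "nat \<Rightarrow> real"
  proof (rule Bochner_Integration.integrable_bound[OF that(2)])
    have [measurable]: "f \<in> borel_measurable borel" using that(1) by (rule borel_measurable_continuous_onI)
    have [measurable]: "(\<lambda>t. \<Sum>i<Suc k. \<xi> i * t i) \<in> borel_measurable (leb (Suc k))"
      by (intro borel_measurable_sum borel_measurable_times measurable_leb_component) auto
    show "(\<lambda>t. complex_of_real (f (y + frame_map (Suc k) E t)) * iexp (s * (\<Sum>i<Suc k. \<xi> i * t i))) \<in> borel_measurable (leb (Suc k))"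
      by measurable
  qed (auto simp: norm_mult)
  have "f1 y - f2 y = 0"
  proof (rule fourier_zero[where g = "\<lambda>v. f1 v - f2 v", OF _ E])
    show "AE \<xi> in gaussian (Suc k). \<forall>s. (CLINT t | leb (Suc k). complex_of_real (f1 (y + frame_map (Suc k) E t) - f2 (y + frame_map (Suc k) E t))
        * iexp (s * (\<Sum>i<Suc k. \<xi> i * t i))) = 0"
      using AE_gaussian_component_nonzero[of k "Suc k", OF lessI]
    proof eventually_elim
      case (elim \<xi>)
      show ?case
      proof
        fix s
        have "?F f1 s \<xi> = ?F f2 s \<xi>"
          by (rule fourier_determined_by_slices[where x = x and k = k and W = W and E = E and y = y
                and ?f1.0 = f1 and ?f2.0 = f2 and \<xi> = \<xi>, folded a_def, folded D_def,
                OF dimD W E EW ya EkD f int eq elim])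
        moreover have "?F (\<lambda>v. f1 v - f2 v) s \<xi> = ?F f1 s \<xi> - ?F f2 s \<xi>"
          unfolding of_real_diff left_diff_distrib
          by (rule Bochner_Integration.integral_diff) (intro cint f int)+
        ultimately show "?F (\<lambda>v. f1 v - f2 v) s \<xi> = 0" by simp
      qed
    qed
  qed (use f int in \<open>auto intro!: continuous_intros\<close>)
  then show ?thesis by simp
qed

theorem theorem2p1:
  fixes k :: nat and x :: "nat \<Rightarrow> real ^ 'n" and N :: real and f1 f2 :: "real ^ 'n \<Rightarrow> real"
  assumes "CARD('n) \<ge> 3"
    and "1 \<le> k" and "k \<le> CARD('n) - 2"
    and "general_position k x"
    and "N > real k + 1"
    and "C_infinity f1" and "f1 \<in> o[at_infinity](\<lambda>y. norm y powr (- N))"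
    and "C_infinity f2" and "f2 \<in> o[at_infinity](\<lambda>y. norm y powr (- N))"
    and "\<And>S. S \<in> plane_family k x \<Longrightarrow> radon_transform k f1 S = radon_transform k f2 S"
  shows "f1 = f2"
proof
  fix y
  have "C_times 0 f1" "C_times 0 f2" using assms(6,8) unfolding C_infinity_def by blast+
  then have cont: "continuous_on UNIV f1" "continuous_on UNIV f2" by simp_all
  have "k < CARD('n)" using assms(1,3) by linarith
  then show "f1 y = f2 y" using assms(4,5) cont assms(7,9,10) by (rule eq_at_if_radon_eq_on_family)
qed

end
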